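(* There exist non-degenerate distributions $F_-$ and $F_+$ on $[0,\infty)$ (which may be taken with bounded support, so that $\mathbb{E}Y_\pm<\infty$) such that $$\bar\mu(\mathbf e_2)<\min\{\mu_-(\mathbf e_2),\mu_+(\mathbf e_2)\}.$$
   Context: Inhomogeneous first-passage percolation on $\mathbb{Z}^2$. Given distribution functions $F_-,F_+$ of probability measures on $[0,\infty)$, edge weights $(\tau_e)$ on nearest-neighbour edges of $\mathbb{Z}^2$ are independent; $\tau_e\sim F_-$ if at least one endpoint of $e$ has strictly negative first coordinate, and $\tau_e\sim F_+$ otherwise. $T(u,v)$ is the infimum over nearest-neighbour paths from $u$ to $v$ of the sum of edge weights. $Y_\pm$ is the minimum of four i.i.d. $F_\pm$ variables. $\bar\mu(\mathbf e_2)=\lim_n T(0,n\mathbf e_2)/n$ (almost surely). $\mu_\pm(x)$ is the time constant of homogeneous first-passage percolation with i.i.d. $F_\pm$ weights, i.e. the limit in probability of $T_{F_\pm}(0,nx)/n$. A distribution is non-degenerate if it is not a point mass. *)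

theory Defs
  imports "HOL-Probability.Probability"
begin

type_synonym vertex = "int \<times> int"

text \<open>Nearest-neighbour edges of Z^2: (u, False) is the edge {u, u+(1,0)},
  (u, True) is the edge {u, u+(0,1)}.  Every edge has exactly one such name.\<close>
type_synonym edge = "vertex \<times> bool"

definition edge_ends :: "edge \<Rightarrow> vertex \<times> vertex" where
  "edge_ends e = (case e of (u, False) \<Rightarrow> (u, (fst u + 1, snd u))
                          | (u, True)  \<Rightarrow> (u, (fst u, snd u + 1)))"

definition adj :: "vertex \<Rightarrow> vertex \<Rightarrow> bool" where
  "adj u v \<longleftrightarrow> \<bar>fst u - fst v\<bar> + \<bar>snd u - snd v\<bar> = 1"

definition edge_betw :: "vertex \<Rightarrow> vertex \<Rightarrow> edge" where
  "edge_betw u v = Eps (\<lambda>d. edge_ends d = (u, v) \<or> edge_ends d = (v, u))"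

definition is_path :: "vertex list \<Rightarrow> vertex \<Rightarrow> vertex \<Rightarrow> bool" where
  "is_path p u v \<longleftrightarrow> p \<noteq> [] \<and> hd p = u \<and> last p = v \<and>
     (\<forall>i. Suc i < length p \<longrightarrow> adj (p ! i) (p ! Suc i))"

definition path_weight :: "(edge \<Rightarrow> real) \<Rightarrow> vertex list \<Rightarrow> real" where
  "path_weight \<omega> p = (\<Sum>i<length p - 1. \<omega> (edge_betw (p ! i) (p ! Suc i)))"

definition passage_time :: "(edge \<Rightarrow> real) \<Rightarrow> vertex \<Rightarrow> vertex \<Rightarrow> real" where
  "passage_time \<omega> u v = (INF p \<in> {p. is_path p u v}. path_weight \<omega> p)"

definition minus_edge :: "edge \<Rightarrow> bool" where
  "minus_edge e \<longleftrightarrow> fst (fst (edge_ends e)) < 0 \<or> fst (snd (edge_ends e)) < 0"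

definition distr_nonneg :: "real measure \<Rightarrow> bool" where
  "distr_nonneg F \<longleftrightarrow> prob_space F \<and> sets F = sets borel \<and> emeasure F {0..} = 1"

definition nondegenerate :: "real measure \<Rightarrow> bool" where
  "nondegenerate F \<longleftrightarrow> \<not> (\<exists>x. F = return borel x)"

definition bounded_support :: "real measure \<Rightarrow> bool" where
  "bounded_support F \<longleftrightarrow> (\<exists>B. emeasure F {0..B} = 1)"

definition inhom_env :: "real measure \<Rightarrow> real measure \<Rightarrow> (edge \<Rightarrow> real) measure" where
  "inhom_env Fm Fp = PiM UNIV (\<lambda>e. if minus_edge e then Fm else Fp)"

definition hom_env :: "real measure \<Rightarrow> (edge \<Rightarrow> real) measure" where
  "hom_env F = PiM UNIV (\<lambda>e. F)"

definition e2 :: vertex where "e2 = (0, 1)"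

definition scale :: "nat \<Rightarrow> vertex \<Rightarrow> vertex" where
  "scale n x = (int n * fst x, int n * snd x)"

definition is_mu_bar_e2 :: "real measure \<Rightarrow> real measure \<Rightarrow> real \<Rightarrow> bool" where
  "is_mu_bar_e2 Fm Fp c \<longleftrightarrow>
     (AE \<omega> in inhom_env Fm Fp. (\<lambda>n. passage_time \<omega> (0, 0) (scale n e2) / real n) \<longlonglongrightarrow> c)"

definition is_time_constant :: "real measure \<Rightarrow> vertex \<Rightarrow> real \<Rightarrow> bool" where
  "is_time_constant F x c \<longleftrightarrow>
     (\<forall>\<epsilon>>0. (\<lambda>n. measure (hom_env F)
        {\<omega> \<in> space (hom_env F). \<bar>passage_time \<omega> (0, 0) (scale n x) / real n - c\<bar> > \<epsilon>})
        \<longlonglongrightarrow> 0)"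

end

theory Submission
  imports Defs
begin

text \<open>
  Take \<open>F\<^sub>-\<close> uniform on \<open>{1, 1 + 10\<^sup>-\<^sup>6}\<close>, and let \<open>F\<^sub>+\<close> be the small weight \<open>1/6\<close> with
  probability \<open>1/32\<close> and \<open>5\<close> otherwise. All \<open>F\<^sub>-\<close> weights are at least \<open>1\<close>, so \<open>\<mu>\<^sub>- \<ge> 1\<close>; fast
  \<open>F\<^sub>+\<close> edges are so rare that summing \<open>exp (- weight)\<close> over self-avoiding walks gives \<open>\<mu>\<^sub>+ \<ge> 1\<close>.
  At the interface one climbs the column \<open>x = -1\<close> at cost at most \<open>1 + 10\<^sup>-\<^sup>6\<close> per step, but switches to the
  column \<open>x = 0\<close> whenever three consecutive edges there are fast; each such detour saves about
  \<open>1/2\<close>, which outweighs the excess \<open>10\<^sup>-\<^sup>6\<close> and brings the rate below \<open>1\<close>.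

  Existence of the limits: with bounded weights, changing finitely many weights changes
  \<open>T(0, n e\<^sub>2)\<close> by a bounded amount, so the events that \<open>T(0, n e\<^sub>2) - c n\<close> is unbounded below
  (above) have probability 0 or 1. A greedy covering argument in the style of Katznelson and Weiss
  shows that probability 1 forces \<open>c \<ge> \<mu>\<close> (respectively \<open>c \<le> \<mu>\<close>), where \<open>\<mu>\<close> is
  the infimum of \<open>E T(0, m e\<^sub>2) / m\<close>. It uses only invariance under vertical shifts, so it covers the
  homogeneous and the inhomogeneous environment alike.
\<close>

section \<open>Subadditive processes\<close>

lemma (in prob_space) integral_measure_preserving_funpow:
  fixes f :: "'a \<Rightarrow> real"
  assumes \<theta>: "\<theta> \<in> measurable M M" "distr M M \<theta> = M"
    and f: "f \<in> borel_measurable M"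
  shows "(\<integral>x. f ((\<theta> ^^ n) x) \<partial>M) = (\<integral>x. f x \<partial>M)"
proof (induction n)
  case (Suc n)
  have meas: "(\<lambda>x. f ((\<theta> ^^ n) x)) \<in> borel_measurable M"
    using measurable_compose_n[OF \<theta>(1)] f by measurable
  have "(\<integral>x. f ((\<theta> ^^ Suc n) x) \<partial>M) = (\<integral>x. f ((\<theta> ^^ n) (\<theta> x)) \<partial>M)"
    by (simp add: funpow_swap1)
  also have "\<dots> = (\<integral>x. f ((\<theta> ^^ n) x) \<partial>distr M M \<theta>)"
    using \<theta>(1) meas by (simp add: integral_distr)
  also have "\<dots> = (\<integral>x. f x \<partial>M)"
    using Suc \<theta>(2) by simp
  finally show ?case .
qed simp

text \<open>Cut the orbit of a point greedily into stretches along which the process is at most \<open>c\<close> per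
  step; only at bad points, and in the last incomplete stretch, does one pay the trivial bound.\<close>

lemma subadditive_greedy_bound:
  fixes f :: "nat \<Rightarrow> 'a \<Rightarrow> real" and c B :: real and K :: nat
  assumes sub: "\<And>m n x. f (m + n) x \<le> f m x + f n ((\<theta> ^^ m) x)"
    and bound: "\<And>n x. f n x \<le> B * real n" and "0 \<le> B"
  defines "C \<equiv> B + \<bar>c\<bar>"
    and "bad \<equiv> {x. \<forall>n\<in>{1..K}. f n x > c * real n}"
  shows "f N x \<le> c * real N + C * (\<Sum>j<N. indicator bad ((\<theta> ^^ j) x)) + C * real K"
proof (induction N arbitrary: x rule: less_induct)
  case (less N)
  \<comment> \<open>\<open>C\<close> is chosen so that \<open>B \<le> c + C\<close> for either sign
    of \<open>c\<close>: a step that costs the trivial bound \<open>B\<close> is paid by its share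
    \<open>c\<close> of the main term and one unit \<open>C\<close> of the error term.\<close>
  have C: "C \<ge> 0" "B \<le> c + C" using \<open>0 \<le> B\<close> by (auto simp: C_def)
  have split: "(\<Sum>j<N. indicator bad ((\<theta> ^^ j) x)) =
      (\<Sum>j<n. indicator bad ((\<theta> ^^ j) x)) + (\<Sum>j<N - n. (indicator bad ((\<theta> ^^ j) ((\<theta> ^^ n) x)) :: real))"
    if "n \<le> N" for n
  proof -
    have "(\<Sum>j<N. (indicator bad ((\<theta> ^^ j) x) :: real)) =
        (\<Sum>j<n. indicator bad ((\<theta> ^^ j) x)) + (\<Sum>j=n..<N. indicator bad ((\<theta> ^^ j) x))"
      using that by (metis lessThan_atLeast0 sum.atLeastLessThan_concat zero_le)
    also have "(\<Sum>j=n..<N. (indicator bad ((\<theta> ^^ j) x) :: real)) =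
        (\<Sum>j<N - n. indicator bad ((\<theta> ^^ (j + n)) x))"
      using that sum.shift_bounds_nat_ivl[of "\<lambda>j. (indicator bad ((\<theta> ^^ j) x) :: real)" 0 n "N - n"]
      by (simp add: lessThan_atLeast0)
    finally show ?thesis by (simp add: funpow_add)
  qed
  have nonneg: "0 \<le> (\<Sum>j<n. (indicator bad ((\<theta> ^^ j) x) :: real))" for n
    by (intro sum_nonneg) auto
  show ?case
  proof (cases "N = 0")
    case True
    then show ?thesis using order_trans[OF bound[of 0 x], of "C * real K"] C by simp
  next
    case False
    show ?thesis
    proof (cases "x \<in> bad")
      case True
      have "f N x \<le> f 1 x + f (N - 1) ((\<theta> ^^ 1) x)"
        using sub[of 1 "N - 1" x] False by simp
      also have "\<dots> \<le> B + (c * real (N - 1) +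
          C * (\<Sum>j<N - 1. indicator bad ((\<theta> ^^ j) ((\<theta> ^^ 1) x))) + C * real K)"
        using bound[of 1 x] less[of "N - 1" "(\<theta> ^^ 1) x"] False by (intro add_mono) auto
      also have "\<dots> \<le> c * real N + C * (\<Sum>j<N. indicator bad ((\<theta> ^^ j) x)) + C * real K"
        using split[of 1] True False C by (simp add: of_nat_diff algebra_simps)
      finally show ?thesis .
    next
      case nb: False
      then obtain n where n: "n \<in> {1..K}" "f n x \<le> c * real n"
        by (auto simp: bad_def not_less)
      show ?thesis
      proof (cases "n \<le> N")
        case True
        have "f N x \<le> f n x + f (N - n) ((\<theta> ^^ n) x)"
          using sub[of n "N - n" x] True by simp
        also have "\<dots> \<le> c * real n + (c * real (N - n) +
            C * (\<Sum>j<N - n. indicator bad ((\<theta> ^^ j) ((\<theta> ^^ n) x))) + C * real K)"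
          using n less[of "N - n" "(\<theta> ^^ n) x"] True False by (intro add_mono) auto
        also have "\<dots> \<le> c * real N + C * (\<Sum>j<N. indicator bad ((\<theta> ^^ j) x)) + C * real K"
          unfolding split[OF True] using C nonneg[of n] True
          by (simp add: of_nat_diff algebra_simps)
        finally show ?thesis .
      next
        case False
        then have "N \<le> K" using n by auto
        have "f N x \<le> B * real N" by (rule bound)
        also have "\<dots> \<le> (c + C) * real N" using C by (intro mult_right_mono) auto
        also have "\<dots> \<le> c * real N + C * real K"
          using C \<open>N \<le> K\<close> by (simp add: algebra_simps mult_left_mono)
        finally show ?thesis using mult_nonneg_nonneg[OF C(1) nonneg[of N]] by linarith
      qed
    qed
  qed
qed

text \<open>The greedy bound is integrated. By invariance all bad indicators along the orbit have
  the same mean, which becomes small for large \<open>K\<close> because almost every point leaves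
  \<open>bad K\<close> eventually. With \<open>K\<close> fixed, a large \<open>N\<close> makes the
  boundary term \<open>C * real K\<close> at most half of
  \<open>\<epsilon> * real N\<close>.\<close>

lemma (in prob_space) subadditive_expectation_le:
  fixes f :: "nat \<Rightarrow> 'a \<Rightarrow> real"
  assumes \<theta>: "\<theta> \<in> measurable M M" "distr M M \<theta> = M"
    and meas: "\<And>n. f n \<in> borel_measurable M"
    and sub: "\<And>m n x. f (m + n) x \<le> f m x + f n ((\<theta> ^^ m) x)"
    and bound: "\<And>n x. \<bar>f n x\<bar> \<le> B * real n"
    and good: "AE x in M. \<exists>n\<ge>1. f n x \<le> c * real n"
    and "\<epsilon> > 0"
  shows "\<exists>N\<ge>1. (\<integral>x. f N x \<partial>M) \<le> (c + \<epsilon>) * real N"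
proof -
  note [measurable] = meas \<theta>(1)
  \<comment> \<open>The extra 1 keeps \<open>C\<close> positive, so that the threshold
    \<open>\<epsilon> / (2 * C)\<close> makes sense.\<close>
  define C where "C = B + \<bar>c\<bar> + 1"
  have B: "0 \<le> B" using bound[of 1 undefined] by simp
  define bad where "bad K = {x. \<forall>n\<in>{1..K}. f n x > c * real n}" for K
  have bad_sets [measurable]: "bad K \<inter> space M \<in> sets M" for K
    unfolding bad_def by measurable
  have bad_meas [measurable]: "(indicator (bad K) :: 'a \<Rightarrow> real) \<in> borel_measurable M" for K
    using bad_sets[of K] by (simp add: borel_measurable_indicator_iff Int_commute)
  have "(\<lambda>K. \<integral>x. (indicator (bad K) x :: real) \<partial>M) \<longlonglongrightarrow> (\<integral>x. 0 \<partial>M)"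
  proof (rule integral_dominated_convergence)
    show "AE x in M. (\<lambda>K. indicator (bad K) x) \<longlonglongrightarrow> (0::real)"
      using good
    proof eventually_elim
      case (elim x)
      then obtain n where "n \<ge> 1" "f n x \<le> c * real n" by auto
      then have "eventually (\<lambda>K. indicator (bad K) x = (0::real)) sequentially"
        by (intro eventually_sequentiallyI[of n]) (force simp: bad_def indicator_def)
      then show ?case by (rule tendsto_eventually)
    qed
    show "integrable M (\<lambda>_. 1::real)" by simp
  qed (auto split: split_indicator)
  then have "eventually (\<lambda>K. (\<integral>x. (indicator (bad K) x :: real) \<partial>M) < \<epsilon> / (2 * C)) sequentially"
    using \<open>\<epsilon> > 0\<close> B by (intro order_tendstoD) (auto simp: C_def)
  then obtain K where K: "(\<integral>x. (indicator (bad K) x :: real) \<partial>M) < \<epsilon> / (2 * C)"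
    by (auto simp: eventually_sequentially)
  obtain N0 :: nat where N0: "real N0 > 2 * C * real K / \<epsilon>"
    using reals_Archimedean2 by blast
  define N where "N = Suc N0"
  have N: "real N > 2 * C * real K / \<epsilon>" "N \<ge> 1"
    using N0 by (auto simp: N_def)
  have intf: "integrable M (f N)"
    by (rule integrable_const_bound[where B = "B * real N"]) (use bound in auto)
  have \<theta>n [measurable]: "(\<theta> ^^ j) \<in> measurable M M" for j
    by (rule measurable_compose_n) (rule \<theta>(1))
  have intb: "integrable M (\<lambda>x. indicator (bad K) ((\<theta> ^^ j) x) :: real)" for j
    by (rule integrable_const_bound[where B = 1]) (auto split: split_indicator)
  have "(\<integral>x. f N x \<partial>M) \<le>
      (\<integral>x. c * real N + C * (\<Sum>j<N. indicator (bad K) ((\<theta> ^^ j) x)) + C * real K \<partial>M)"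
  proof (rule integral_mono[OF intf])
    show "integrable M (\<lambda>x. c * real N + C * (\<Sum>j<N. indicator (bad K) ((\<theta> ^^ j) x)) + C * real K)"
      using intb by simp
    fix x
    have le: "f n x \<le> B * real n" for n x using bound[of n x] by linarith
    have "f N x \<le> c * real N + (B + \<bar>c\<bar>) * (\<Sum>j<N. indicator (bad K) ((\<theta> ^^ j) x))
        + (B + \<bar>c\<bar>) * real K"
      unfolding bad_def by (rule subadditive_greedy_bound[OF sub le B])
    also have "\<dots> \<le> c * real N + C * (\<Sum>j<N. indicator (bad K) ((\<theta> ^^ j) x)) + C * real K"
      by (intro add_mono mult_right_mono sum_nonneg) (auto simp: C_def)
    finally show "f N x \<le> c * real N + C * (\<Sum>j<N. indicator (bad K) ((\<theta> ^^ j) x)) + C * real K" .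
  qed
  also have "\<dots> = c * real N + C * (real N * (\<integral>x. indicator (bad K) x \<partial>M)) + C * real K"
    using intb by (simp add: integral_measure_preserving_funpow[OF \<theta>] prob_space)
  also have "\<dots> \<le> c * real N + C * (real N * (\<epsilon> / (2 * C))) + \<epsilon> / 2 * real N"
  proof -
    have "C * real K \<le> \<epsilon> / 2 * real N"
      using N \<open>\<epsilon> > 0\<close> by (simp add: field_simps)
    moreover have "C > 0" using B by (simp add: C_def)
    ultimately show ?thesis
      using K by (intro add_mono[OF add_mono[OF order_refl]] mult_left_mono) auto
  qed
  also have "\<dots> = (c + \<epsilon>) * real N"
    using B by (simp add: C_def field_simps add_pos_nonneg)
  finally show ?thesis using N by blast
qed

section \<open>A zero-one law for product measures\<close>

lemma indep_vars_PiM_coordinates: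
  assumes D: "\<And>i. prob_space (D i)" and "I \<noteq> {}"
  shows "prob_space.indep_vars (PiM I D) D (\<lambda>i \<omega>. \<omega> i) I"
proof -
  interpret prob_space "PiM I D" by (rule prob_space_PiM) (rule D)
  show ?thesis
    using \<open>I \<noteq> {}\<close>
  proof (subst indep_vars_iff_distr_eq_PiM')
    have "distr (PiM I D) (PiM I D) (\<lambda>x. restrict x I) = distr (PiM I D) (PiM I D) (\<lambda>x. x)"
      by (rule distr_cong) (auto simp: space_PiM PiE_def extensional_restrict)
    moreover have "PiM I (\<lambda>i. distr (PiM I D) (D i) (\<lambda>\<omega>. \<omega> i)) = PiM I D"
      by (rule PiM_cong) (auto intro: distr_PiM_component D)
    ultimately show "distr (PiM I D) (PiM I D) (\<lambda>x. \<lambda>i\<in>I. x i) = PiM I (\<lambda>i. distr (PiM I D) (D i) (\<lambda>\<omega>. \<omega> i))"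
      by simp
  qed auto
qed

lemma PiM_zero_one_law:
  fixes D :: "'i \<Rightarrow> 'a measure"
  assumes D: "\<And>i. prob_space (D i)" and sp: "\<And>i. space (D i) = UNIV"
    and cnt: "countable (UNIV :: 'i set)" "infinite (UNIV :: 'i set)"
    and S: "S \<in> sets (PiM UNIV D)"
    and inv: "\<And>\<omega> \<omega>'. finite {i. \<omega> i \<noteq> \<omega>' i} \<Longrightarrow> \<omega> \<in> S \<Longrightarrow> \<omega>' \<in> S"
  shows "measure (PiM UNIV D) S = 0 \<or> measure (PiM UNIV D) S = 1"
proof -
  interpret prob_space "PiM UNIV D" by (rule prob_space_PiM) (rule D)
  have spM: "space (PiM UNIV D) = UNIV" by (simp add: space_PiM sp)
  define h :: "nat \<Rightarrow> 'i" where "h = from_nat_into UNIV"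
  have h: "bij h" unfolding h_def using cnt by (rule bij_betw_from_nat_into)
  define A where "A n = {(\<lambda>\<omega>. \<omega> (h n)) -` B | B. B \<in> sets (D (h n))}" for n
  have "indep_vars (\<lambda>n. D (h n)) (\<lambda>n \<omega>. \<omega> (h n)) UNIV"
  proof (subst indep_vars_iff_distr_eq_PiM')
    show "distr (PiM UNIV D) (PiM UNIV (\<lambda>n. D (h n))) (\<lambda>\<omega>. \<lambda>n\<in>UNIV. \<omega> (h n)) =
        PiM UNIV (\<lambda>n. distr (PiM UNIV D) (D (h n)) (\<lambda>\<omega>. \<omega> (h n)))"
      using distr_PiM_reindex[of UNIV D h UNIV] D h
      by (simp add: distr_PiM_component bij_is_inj)
  qed auto
  then have indep: "indep_sets A UNIV"
    unfolding A_def[abs_def] by (simp add: indep_vars_def2 spM)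
  show ?thesis
  proof (rule kolmogorov_0_1_law[OF _ indep])
    show "sigma_algebra (space (PiM UNIV D)) (A i)" for i
      using sets.sigma_algebra_axioms[of "vimage_algebra UNIV (\<lambda>\<omega>. \<omega> (h i)) (D (h i))"]
      by (simp add: sets_vimage_algebra2 spM sp A_def)
    show "S \<in> tail_events A"
      unfolding tail_events_def spM
    proof
      fix n :: nat
      let ?N = "sigma UNIV (\<Union> (A ` {n..}))"
      \<comment> \<open>Any fixed configuration would do, since every \<open>D i\<close> has the
        whole type as its space.\<close>
      define \<omega>0 :: "'i \<Rightarrow> 'a" where "\<omega>0 = undefined"
      define g where "g \<omega> = (\<lambda>i. if i \<in> h ` {..<n} then \<omega>0 i else \<omega> i)" for \<omega> :: "'i \<Rightarrow> 'a"
      have "g \<in> measurable ?N (PiM UNIV D)"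
      proof (rule measurable_PiM_single')
        show "(\<lambda>\<omega>. g \<omega> i) \<in> measurable ?N (D i)" for i
        proof (cases "i \<in> h ` {..<n}")
          case True
          then show ?thesis by (simp add: g_def sp)
        next
          case False
          obtain k where k: "i = h k" using h by (metis bij_pointE)
          with False have "k \<ge> n" by (metis imageI lessThan_iff not_le)
          have "(\<lambda>\<omega>. \<omega> i) \<in> measurable ?N (D i)"
          proof (rule measurableI)
            fix B assume "B \<in> sets (D i)"
            then have "(\<lambda>\<omega>. \<omega> i) -` B \<in> \<Union> (A ` {n..})"
              using \<open>k \<ge> n\<close> by (auto simp: A_def k)
            then show "(\<lambda>\<omega>. \<omega> i) -` B \<inter> space ?N \<in> sets ?N"
              by (simp add: sets_measure_of_conv space_measure_of_conv sigma_sets.Basic)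
          qed (simp add: sp)
          then show ?thesis using False by (simp add: g_def)
        qed
      qed (simp add: sp)
      from measurable_sets[OF this S] have "g -` S \<in> sigma_sets UNIV (\<Union> (A ` {n..}))"
        by (simp add: space_measure_of_conv)
      moreover have "g -` S = S"
      proof -
        have "finite {i. g \<omega> i \<noteq> \<omega> i}" "finite {i. \<omega> i \<noteq> g \<omega> i}" for \<omega>
          by (rule finite_subset[of _ "h ` {..<n}"]; auto simp: g_def)+
        then show ?thesis using inv by blast
      qed
      ultimately show "S \<in> sigma_sets UNIV (\<Union> (A ` {n..}))" by simp
    qed
  qed
qed

section \<open>Lattice paths and passage times\<close>

definition up_vertex :: "vertex \<Rightarrow> vertex" where
  "up_vertex u = (fst u, snd u + 1)"

definition up_edge :: "edge \<Rightarrow> edge" where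
  "up_edge e = (up_vertex (fst e), snd e)"

definition ends :: "edge \<Rightarrow> vertex set" where
  "ends e = {fst (edge_ends e), snd (edge_ends e)}"

text \<open>With edges as a list, gluing paths becomes concatenation, and the weight of a
  self-avoiding path becomes a sum over a set of edges.\<close>

fun path_edges :: "vertex list \<Rightarrow> edge list" where
  "path_edges (u # v # p) = edge_betw u v # path_edges (v # p)"
| "path_edges _ = []"

section \<open>Edges and their endpoints\<close>

lemma adj_cases:
  assumes "adj u v"
  obtains "v = (fst u + 1, snd u)" | "v = (fst u - 1, snd u)"
    | "v = (fst u, snd u + 1)" | "v = (fst u, snd u - 1)"
proof -
  have "(fst v = fst u + 1 \<and> snd v = snd u) \<or> (fst v = fst u - 1 \<and> snd v = snd u) \<or>
      (fst v = fst u \<and> snd v = snd u + 1) \<or> (fst v = fst u \<and> snd v = snd u - 1)"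
    using assms unfolding adj_def by presburger
  then show thesis using that by (metis prod.collapse)
qed

lemma edge_ends_simps [simp]:
  "edge_ends (u, False) = (u, (fst u + 1, snd u))"
  "edge_ends (u, True) = (u, (fst u, snd u + 1))"
  by (simp_all add: edge_ends_def)

lemma edge_ends_inj: "edge_ends d = edge_ends e \<Longrightarrow> d = e"
  by (cases d; cases e; cases "snd d"; cases "snd e") auto

text \<open>The second endpoint of a named edge always has the larger coordinate sum. Together with
  injectivity this makes the choice in \<open>edge_betw\<close> unique.\<close>

lemma edge_ends_not_swapped: "edge_ends d \<noteq> prod.swap (edge_ends e)"
  by (cases d; cases e; cases "snd d"; cases "snd e") auto

lemma edge_betw_eqI:
  assumes "edge_ends d = (u, v) \<or> edge_ends d = (v, u)"
  shows "edge_betw u v = d"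
  unfolding edge_betw_def
proof (rule some_equality)
  show "edge_ends d = (u, v) \<or> edge_ends d = (v, u)" by (rule assms)
next
  fix d' assume "edge_ends d' = (u, v) \<or> edge_ends d' = (v, u)"
  with assms show "d' = d"
    using edge_ends_inj[of d' d] edge_ends_not_swapped[of d' d] by auto
qed

lemma edge_betw_simps:
  "edge_betw (x, y) (x, y + 1) = ((x, y), True)"
  "edge_betw (x, y) (x + 1, y) = ((x, y), False)"
  "edge_betw (x + 1, y) (x, y) = ((x, y), False)"
  by (rule edge_betw_eqI; simp)+

lemma edge_ends_edge_betw:
  assumes "adj u v"
  shows "edge_ends (edge_betw u v) = (u, v) \<or> edge_ends (edge_betw u v) = (v, u)"
proof -
  from assms have "\<exists>d. edge_ends d = (u, v) \<or> edge_ends d = (v, u)"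
  proof (cases rule: adj_cases)
    case 1 then show ?thesis by (intro exI[of _ "(u, False)"]) simp
  next
    case 2 then show ?thesis by (intro exI[of _ "(v, False)"]) simp
  next
    case 3 then show ?thesis by (intro exI[of _ "(u, True)"]) simp
  next
    case 4 then show ?thesis by (intro exI[of _ "(v, True)"]) simp
  qed
  then show ?thesis using edge_betw_eqI by blast
qed

lemma ends_edge_betw: "adj u v \<Longrightarrow> ends (edge_betw u v) = {u, v}"
  using edge_ends_edge_betw[of u v] by (auto simp: ends_def)

lemma edge_betw_up:
  assumes "adj u v"
  shows "edge_betw (up_vertex u) (up_vertex v) = up_edge (edge_betw u v)"
proof (rule edge_betw_eqI)
  have "edge_ends (up_edge d) = map_prod up_vertex up_vertex (edge_ends d)" for d
    by (cases d; cases "snd d") (auto simp: up_edge_def up_vertex_def)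
  then show "edge_ends (up_edge (edge_betw u v)) = (up_vertex u, up_vertex v) \<or>
      edge_ends (up_edge (edge_betw u v)) = (up_vertex v, up_vertex u)"
    using edge_ends_edge_betw[OF assms] by auto
qed

section \<open>Concatenation and loop erasure of paths\<close>

lemma is_path_iff:
  "is_path p u v \<longleftrightarrow> p \<noteq> [] \<and> hd p = u \<and> last p = v \<and> successively adj p"
  by (auto simp: is_path_def successively_conv_nth)

lemma path_weight_eq: "path_weight \<omega> p = sum_list (map \<omega> (path_edges p))"
proof (induction p rule: path_edges.induct)
  case (1 u v p)
  then show ?case by (simp add: path_weight_def sum.lessThan_Suc_shift del: sum.lessThan_Suc)
qed (simp_all add: path_weight_def)

lemma path_edges_append:
  assumes "p \<noteq> []" "q \<noteq> []"
  shows "path_edges (p @ q) = path_edges p @ edge_betw (last p) (hd q) # path_edges q"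
  using assms
proof (induction p rule: path_edges.induct)
  case ("2_2" v)
  then show ?case by (cases q) auto
qed auto

text \<open>The tail \<open>tl q\<close> drops the common vertex, which would otherwise appear twice
  in a row and create a spurious step.\<close>

lemma path_edges_glue:
  assumes "p \<noteq> []" "q \<noteq> []" "last p = hd q"
  shows "path_edges (p @ tl q) = path_edges p @ path_edges q"
proof (cases "tl q = []")
  case True
  with assms(2) show ?thesis by (cases q) auto
next
  case False
  then have "path_edges q = edge_betw (hd q) (hd (tl q)) # path_edges (tl q)"
    by (cases q rule: path_edges.cases) auto
  with assms False show ?thesis by (simp add: path_edges_append)
qed

lemma length_path_edges: "length (path_edges p) = length p - 1"
  by (induction p rule: path_edges.induct) auto

lemma ends_path_edges:
  "successively adj p \<Longrightarrow> e \<in> set (path_edges p) \<Longrightarrow> ends e \<subseteq> set p"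
  by (induction p rule: path_edges.induct) (auto simp: ends_edge_betw)

text \<open>Using an edge again would mean visiting one of its endpoints again. Hence the weights
  along a self-avoiding walk are distinct coordinates of the environment.\<close>

lemma distinct_path_edges:
  "successively adj p \<Longrightarrow> distinct p \<Longrightarrow> distinct (path_edges p)"
proof (induction p rule: path_edges.induct)
  case (1 u v p)
  then have "edge_betw u v \<notin> set (path_edges (v # p))"
    using ends_path_edges[of "v # p" "edge_betw u v"] ends_edge_betw[of u v] by auto
  with 1 show ?case by simp
qed auto

lemma path_weight_nonneg: "(\<And>e. 0 \<le> \<omega> e) \<Longrightarrow> 0 \<le> path_weight \<omega> p"
  unfolding path_weight_def by (rule sum_nonneg)

lemma is_path_append:
  assumes "is_path p u v" "is_path q v w"
  shows "is_path (p @ tl q) u w"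
proof (cases "tl q = []")
  case True
  with assms show ?thesis by (cases q) (auto simp: is_path_iff)
next
  case False
  then have "successively adj (tl q) \<and> adj (hd q) (hd (tl q))" if "successively adj q"
    using that by (cases q rule: path_edges.cases) auto
  with assms False show ?thesis
    by (auto simp: is_path_iff successively_append_iff last_tl)
qed

lemma is_path_edge: "adj u v \<Longrightarrow> is_path [u, v] u v"
  by (simp add: is_path_iff)

text \<open>An L-shaped path, first vertical and then horizontal. A real infimum is informative only
  over a nonempty set, so lower bounds for \<open>passage_time\<close> rest on this.\<close>

lemma ex_path: "\<exists>p. is_path p u v"
proof -
  have vert: "\<exists>p. is_path p (x, y) (x, y + k)" for x y k :: int
  proof (induction k rule: int_induct[where k = 0])
    case base
    show ?case by (rule exI[of _ "[(x, y)]"]) (simp add: is_path_iff)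
  next
    case (step1 i)
    then show ?case using is_path_append[OF _ is_path_edge[of "(x, y + i)" "(x, y + (i + 1))"]]
      by (auto simp: adj_def)
  next
    case (step2 i)
    then show ?case using is_path_append[OF _ is_path_edge[of "(x, y + i)" "(x, y + (i - 1))"]]
      by (auto simp: adj_def)
  qed
  have horiz: "\<exists>p. is_path p (x, y) (x + k, y)" for x y k :: int
  proof (induction k rule: int_induct[where k = 0])
    case base
    show ?case by (rule exI[of _ "[(x, y)]"]) (simp add: is_path_iff)
  next
    case (step1 i)
    then show ?case using is_path_append[OF _ is_path_edge[of "(x + i, y)" "(x + (i + 1), y)"]]
      by (auto simp: adj_def)
  next
    case (step2 i)
    then show ?case using is_path_append[OF _ is_path_edge[of "(x + i, y)" "(x + (i - 1), y)"]]
      by (auto simp: adj_def)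
  qed
  show ?thesis
    using vert[of "fst u" "snd u" "snd v - snd u"] horiz[of "fst u" "snd v" "fst v - fst u"] is_path_append
    by (cases u; cases v) fastforce
qed

text \<open>Loops are removed from the end backwards: if the vertex put in front already occurs in
  the self-avoiding remainder, the path restarts at that occurrence. Edges are only dropped, so a
  single \<open>q\<close> serves all nonnegative weights at once.\<close>

lemma loop_erasure:
  assumes "is_path p u v"
  obtains q where "is_path q u v" "distinct q"
    "\<And>\<omega>. (\<And>e. 0 \<le> \<omega> e) \<Longrightarrow> path_weight \<omega> q \<le> path_weight \<omega> p"
proof -
  have "\<exists>q. is_path q u v \<and> distinct q \<and>
      (\<forall>\<omega>. (\<forall>e. 0 \<le> \<omega> e) \<longrightarrow> path_weight \<omega> q \<le> path_weight \<omega> p)"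
    using assms
  proof (induction p arbitrary: u)
    case Nil
    then show ?case by (simp add: is_path_iff)
  next
    case (Cons x p)
    show ?case
    proof (cases "p = []")
      case True
      with Cons.prems show ?thesis by (intro exI[of _ "[x]"]) (auto simp: is_path_iff)
    next
      case False
      define y where "y = hd p"
      have p: "is_path p y v" "adj x y" "x = u"
        using Cons.prems False by (cases p; auto simp: is_path_iff y_def)+
      have wp: "path_weight \<omega> (x # p) = \<omega> (edge_betw x y) + path_weight \<omega> p" for \<omega>
        using False by (cases p) (auto simp: path_weight_eq y_def)
      from Cons.IH[OF p(1)] obtain q where q: "is_path q y v" "distinct q"
        "\<And>\<omega>. (\<forall>e. 0 \<le> \<omega> e) \<Longrightarrow> path_weight \<omega> q \<le> path_weight \<omega> p" by blast
      show ?thesis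
      proof (cases "x \<in> set q")
        case True
        then obtain q1 q2 where q12: "q = q1 @ x # q2" by (auto simp: in_set_conv_decomp)
        have "path_weight \<omega> (x # q2) \<le> path_weight \<omega> (x # p)" if \<omega>: "\<forall>e. 0 \<le> \<omega> e" for \<omega>
        proof -
          have "path_weight \<omega> (x # q2) \<le> path_weight \<omega> q"
          proof (cases "q1 = []")
            case False
            then have "path_weight \<omega> q = path_weight \<omega> q1 + \<omega> (edge_betw (last q1) x) + path_weight \<omega> (x # q2)"
              by (simp add: path_weight_eq q12 path_edges_append)
            then show ?thesis using path_weight_nonneg[of \<omega> q1, OF spec[OF \<omega>]] spec[OF \<omega>, of "edge_betw (last q1) x"] by linarith
          qed (simp add: q12)
          also have "\<dots> \<le> path_weight \<omega> (x # p)" using q(3)[OF \<omega>] spec[OF \<omega>, of "edge_betw x y"] wp[of \<omega>] by linarith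
          finally show ?thesis .
        qed
        moreover have "is_path (x # q2) u v" "distinct (x # q2)"
          using q(1,2) p(3) by (auto simp: is_path_iff q12 successively_append_iff)
        ultimately show ?thesis by blast
      next
        case False
        have "q \<noteq> []" "hd q = y" using q(1) by (auto simp: is_path_iff)
        then have "path_weight \<omega> (x # q) = \<omega> (edge_betw x y) + path_weight \<omega> q" for \<omega>
          by (cases q) (auto simp: path_weight_eq)
        moreover have "is_path (x # q) u v"
          using q(1) p by (cases q) (auto simp: is_path_iff)
        ultimately show ?thesis using False q wp by (intro exI[of _ "x # q"]) auto
      qed
    qed
  qed
  then show thesis using that by blast
qed

lemma path_length_ge:
  assumes "is_path p u v"
  shows "snd v - snd u \<le> int (length p - 1)"
proof -
  have "p \<noteq> [] \<Longrightarrow> successively adj p \<Longrightarrow> snd (last p) - snd (hd p) \<le> int (length p - 1)"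
  proof (induction p rule: path_edges.induct)
    case (1 u v p)
    then have "snd v - snd u \<le> 1" by (auto simp: adj_def)
    with 1 show ?case by auto
  qed auto
  with assms show ?thesis by (simp add: is_path_iff)
qed

section \<open>Passage times: triangle inequality, shifts and perturbations\<close>

lemma passage_time_le:
  assumes "\<And>e. 0 \<le> \<omega> e" "is_path p u v"
  shows "passage_time \<omega> u v \<le> path_weight \<omega> p"
  unfolding passage_time_def
  by (rule cINF_lower) (use assms path_weight_nonneg in \<open>auto intro!: bdd_belowI[of _ 0]\<close>)

lemma passage_time_ge:
  assumes "\<And>p. is_path p u v \<Longrightarrow> c \<le> path_weight \<omega> p"
  shows "c \<le> passage_time \<omega> u v"
  unfolding passage_time_def
  by (rule cINF_greatest) (use assms ex_path in auto)

lemma passage_time_nonneg: "(\<And>e. 0 \<le> \<omega> e) \<Longrightarrow> 0 \<le> passage_time \<omega> u v"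
  by (rule passage_time_ge) (rule path_weight_nonneg)

lemma passage_time_triangle:
  assumes "\<And>e. 0 \<le> \<omega> e"
  shows "passage_time \<omega> u w \<le> passage_time \<omega> u v + passage_time \<omega> v w"
proof -
  have "passage_time \<omega> u w - passage_time \<omega> v w \<le> path_weight \<omega> p" if p: "is_path p u v" for p
  proof -
    have "passage_time \<omega> u w - path_weight \<omega> p \<le> path_weight \<omega> q" if q: "is_path q v w" for q
    proof -
      have "path_weight \<omega> (p @ tl q) = path_weight \<omega> p + path_weight \<omega> q"
        using p q by (simp add: path_weight_eq path_edges_glue is_path_iff)
      then show ?thesis using passage_time_le[of \<omega>, OF assms is_path_append[OF p q]] by simp
    qed
    then have "passage_time \<omega> u w - path_weight \<omega> p \<le> passage_time \<omega> v w" by (rule passage_time_ge)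
    then show ?thesis by simp
  qed
  then have "passage_time \<omega> u w - passage_time \<omega> v w \<le> passage_time \<omega> u v" by (rule passage_time_ge)
  then show ?thesis by simp
qed

lemma passage_time_edge:
  assumes "\<And>e. 0 \<le> \<omega> e" "adj u v"
  shows "passage_time \<omega> u v \<le> \<omega> (edge_betw u v)"
  using passage_time_le[of \<omega>, OF assms(1) is_path_edge[OF assms(2)]] by (simp add: path_weight_eq)

lemma passage_time_vertical:
  assumes "\<And>e. 0 \<le> \<omega> e"
  shows "passage_time \<omega> (x, y) (x, y + int n) \<le> (\<Sum>i<n. \<omega> ((x, y + int i), True))"
proof (induction n)
  case 0
  show ?case using passage_time_le[of \<omega>, OF assms, of "[(x, y)]" "(x, y)" "(x, y)"]
    by (simp add: is_path_iff path_weight_eq)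
next
  case (Suc n)
  have "passage_time \<omega> (x, y + int n) (x, y + int n + 1) \<le> \<omega> ((x, y + int n), True)"
    using passage_time_edge[of \<omega>, OF assms, of "(x, y + int n)" "(x, y + int n + 1)"]
    by (simp add: edge_betw_simps adj_def)
  then show ?case
    using Suc passage_time_triangle[of \<omega> "(x, y)" "(x, y + int (Suc n))" "(x, y + int n)", OF assms]
    by (simp add: add_ac)
qed

lemma passage_time_up:
  "passage_time (\<lambda>e. \<omega> (up_edge e)) u v = passage_time \<omega> (up_vertex u) (up_vertex v)"
proof -
  have adj_up: "adj (up_vertex x) (up_vertex y) \<longleftrightarrow> adj x y" for x y
    by (simp add: adj_def up_vertex_def)
  have "bij up_vertex"
    by (rule o_bij[where g = "\<lambda>u. (fst u, snd u - 1)"]) (auto simp: up_vertex_def)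
  then have inj: "inj up_vertex" and surj: "\<And>p. \<exists>q. p = map up_vertex q"
    by (auto simp: bij_def) (metis ex_map_conv surj_def)
  have paths: "{p. is_path p (up_vertex u) (up_vertex v)} = map up_vertex ` {p. is_path p u v}"
  proof -
    have "is_path (map up_vertex p) (up_vertex u) (up_vertex v) \<longleftrightarrow> is_path p u v" for p
      using inj by (auto simp: is_path_iff successively_map hd_map last_map adj_up inj_eq)
    then show ?thesis using surj by (auto simp: image_iff) metis
  qed
  have "path_weight (\<lambda>e. \<omega> (up_edge e)) p = path_weight \<omega> (map up_vertex p)" if "is_path p u v" for p
  proof -
    have "successively adj p \<Longrightarrow> path_edges (map up_vertex p) = map up_edge (path_edges p)"
      by (induction p rule: path_edges.induct) (auto simp: edge_betw_up)
    then show ?thesis using that by (simp add: path_weight_eq is_path_iff comp_def)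
  qed
  then show ?thesis
    unfolding passage_time_def paths image_image by (intro INF_cong) auto
qed

text \<open>A self-avoiding path crosses each changed edge at most once and loses at most
  \<open>b\<close> there. Loop erasure comes first because a general path could cross such an edge
  arbitrarily often.\<close>

lemma passage_time_finite_change:
  assumes E: "finite E" "\<And>e. e \<notin> E \<Longrightarrow> \<omega> e = \<omega>' e"
    and \<omega>: "\<And>e. 0 \<le> \<omega> e" "\<And>e. \<omega> e \<le> b" and \<omega>': "\<And>e. 0 \<le> \<omega>' e" "\<And>e. \<omega>' e \<le> b"
  shows "passage_time \<omega> u v \<le> passage_time \<omega>' u v + b * real (card E)"
proof -
  have b: "0 \<le> b" using \<omega>[of undefined] by linarith
  have "passage_time \<omega> u v - b * real (card E) \<le> path_weight \<omega>' p" if p: "is_path p u v" for p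
  proof -
    from loop_erasure[OF p] obtain q where q: "is_path q u v" "distinct q"
      "path_weight \<omega>' q \<le> path_weight \<omega>' p" using \<omega>' by metis
    define F where "F = set (path_edges q)"
    have w: "path_weight \<eta> q = sum \<eta> F" for \<eta>
      using q distinct_path_edges[of q]
      by (simp add: path_weight_eq F_def is_path_iff sum_list_distinct_conv_sum_set)
    have "sum \<omega> F - sum \<omega>' F = (\<Sum>e\<in>F. \<omega> e - \<omega>' e)" by (simp add: sum_subtractf)
    also have "\<dots> = (\<Sum>e\<in>F \<inter> E. \<omega> e - \<omega>' e)"
      using E by (intro sum.mono_neutral_right) (auto simp: F_def)
    also have "\<dots> \<le> (\<Sum>e\<in>F \<inter> E. b)"
      by (intro sum_mono) (smt (verit) \<omega> \<omega>')
    also have "\<dots> \<le> b * real (card E)"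
      using b E by (simp add: mult.commute mult_left_mono card_mono)
    finally show ?thesis using passage_time_le[of \<omega>, OF \<omega>(1) q(1)] q(3) w by simp
  qed
  then have "passage_time \<omega> u v - b * real (card E) \<le> passage_time \<omega>' u v" by (rule passage_time_ge)
  then show ?thesis by simp
qed

lemma passage_time_ge_length:
  assumes "\<And>e. 1 \<le> \<omega> e"
  shows "real n \<le> passage_time \<omega> (0, 0) (0, int n)"
proof (rule passage_time_ge)
  fix p assume "is_path p (0, 0) (0, int n)"
  then have "real n \<le> real (length p - 1)" using path_length_ge by fastforce
  also have "\<dots> = (\<Sum>i<length p - 1. 1)" by simp
  also have "\<dots> \<le> path_weight \<omega> p"
    unfolding path_weight_def using assms by (intro sum_mono) auto
  finally show "real n \<le> path_weight \<omega> p" .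
qed

section \<open>Counting walks\<close>

definition walks :: "vertex \<Rightarrow> nat \<Rightarrow> vertex list set" where
  "walks u n = {p. length p = Suc n \<and> hd p = u \<and> successively adj p}"

lemma card_walks: "finite (walks u n) \<and> card (walks u n) \<le> 4 ^ n"
proof (induction n arbitrary: u)
  case 0
  have "walks u 0 = {[u]}" by (auto simp: walks_def length_Suc_conv)
  then show ?case by simp
next
  case (Suc n)
  define nb where "nb = {(fst u + 1, snd u), (fst u - 1, snd u), (fst u, snd u + 1), (fst u, snd u - 1)}"
  have nb: "finite nb" "card nb \<le> 4" by (auto simp: nb_def card_insert_if)
  have sub: "walks u (Suc n) \<subseteq> (\<Union>v\<in>nb. (#) u ` walks v n)"
  proof
    fix p assume "p \<in> walks u (Suc n)"
    then obtain v q where "p = u # v # q" "length q = n" "adj u v" "successively adj (v # q)"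
      by (auto simp: walks_def length_Suc_conv)
    moreover from \<open>adj u v\<close> have "v \<in> nb" by (cases rule: adj_cases) (auto simp: nb_def)
    ultimately show "p \<in> (\<Union>v\<in>nb. (#) u ` walks v n)"
      by (intro UN_I[of v] image_eqI[of _ _ "v # q"]) (auto simp: walks_def)
  qed
  have fin: "finite (\<Union>v\<in>nb. (#) u ` walks v n)" using Suc nb by auto
  have "card (walks u (Suc n)) \<le> card (\<Union>v\<in>nb. (#) u ` walks v n)" by (rule card_mono[OF fin sub])
  also have "\<dots> \<le> (\<Sum>v\<in>nb. card ((#) u ` walks v n))" by (rule card_UN_le[OF nb(1)])
  also have "\<dots> \<le> (\<Sum>v\<in>nb. 4 ^ n)"
    using Suc by (intro sum_mono) (meson card_image_le order_trans)
  also have "\<dots> \<le> 4 ^ Suc n" using nb by simp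
  finally show ?case using fin sub finite_subset by blast
qed

text \<open>It suffices to sum over walks with exactly \<open>n\<close> edges: every path to distance \<open>n\<close>
  has, after loop erasure, an initial segment of this length.\<close>

lemma exp_passage_time_le:
  assumes \<omega>: "\<And>e. 0 \<le> \<omega> e"
  shows "exp (- passage_time \<omega> (0, 0) (0, int n)) \<le>
    (\<Sum>p\<in>{p \<in> walks (0, 0) n. distinct p}. exp (- path_weight \<omega> p))"
    (is "_ \<le> ?S")
proof -
  have S: "exp (- path_weight \<omega> p) \<le> ?S" if p: "is_path p (0, 0) (0, int n)" for p
  proof -
    from loop_erasure[OF p] obtain q where q: "is_path q (0, 0) (0, int n)" "distinct q"
      "path_weight \<omega> q \<le> path_weight \<omega> p" using \<omega> by metis
    define r where "r = take (Suc n) q"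
    have len: "Suc n \<le> length q"
      using path_length_ge[OF q(1)] q(1) by (cases q) (auto simp: is_path_iff)
    have qr: "q = r @ drop (Suc n) q" by (simp add: r_def)
    have "successively adj r"
      using q(1) successively_append_iff[of adj r "drop (Suc n) q"] qr by (auto simp: is_path_iff)
    then have r: "r \<in> {p \<in> walks (0, 0) n. distinct p}"
      using q len by (auto simp: walks_def r_def is_path_iff hd_take)
    have "path_weight \<omega> r \<le> path_weight \<omega> q"
    proof -
      have "path_weight \<omega> r = (\<Sum>i<n. \<omega> (edge_betw (q ! i) (q ! Suc i)))"
        unfolding path_weight_def using len by (intro sum.cong) (auto simp: r_def)
      also have "\<dots> \<le> path_weight \<omega> q"
        unfolding path_weight_def using len \<omega> by (intro sum_mono2) auto
      finally show ?thesis .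
    qed
    with q have "exp (- path_weight \<omega> p) \<le> exp (- path_weight \<omega> r)" by simp
    also have "\<dots> \<le> ?S"
      using r card_walks[of "(0, 0)" n] by (intro member_le_sum) auto
    finally show ?thesis .
  qed
  \<comment> \<open>The bound holds path by path and is carried to the infimum in logarithmic form,
    which requires a positive sum; the existence of one path supplies it.\<close>
  obtain p where "is_path p (0, 0) (0, int n)" using ex_path by blast
  from less_le_trans[OF exp_gt_zero S[OF this]] have pos: "?S > 0" .
  have "- ln ?S \<le> passage_time \<omega> (0, 0) (0, int n)"
  proof (rule passage_time_ge)
    fix p assume "is_path p (0, 0) (0, int n)"
    from ln_mono[OF S[OF this]] show "- ln ?S \<le> path_weight \<omega> p" by simp
  qed
  then have "exp (- passage_time \<omega> (0, 0) (0, int n)) \<le> exp (ln ?S)" by simp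
  with pos show ?thesis by simp
qed

text \<open>Paths are lists over a countable type, so the infimum is a countable one.\<close>

lemma measurable_passage_time:
  assumes [measurable]: "\<And>e. (\<lambda>x. f x e) \<in> borel_measurable M"
  shows "(\<lambda>x. passage_time (f x) u v) \<in> borel_measurable M"
  unfolding passage_time_def
proof (rule borel_measurable_cINF_real)
  show "countable {p. is_path p u v}" by simp
  show "(\<lambda>x. path_weight (f x) p) \<in> borel_measurable M" for p
    unfolding path_weight_def by measurable
qed

section \<open>Stationary first-passage percolation\<close>

text \<open>The law of a weight may depend on the column and direction of its edge but not on its
  height. This covers both homogeneous environments and the two half-planes glued along the vertical
  axis.\<close>

locale vertically_stationary_fpp =
  fixes D :: "edge \<Rightarrow> real measure" and b :: real
  assumes prob_D: "prob_space (D e)"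
    and sets_D [measurable_cong]: "sets (D e) = sets borel"
    and support_D: "AE w in D e. 0 \<le> w \<and> w \<le> b"
    and D_up: "D (up_edge e) = D e"
    and b_nonneg: "0 \<le> b"
begin

abbreviation "env \<equiv> PiM UNIV D"

sublocale prob_space env
  by (rule prob_space_PiM) (rule prob_D)

lemma space_D: "space (D e) = UNIV"
  using sets_eq_imp_space_eq[OF sets_D, of e] by simp

lemma space_env: "space env = UNIV"
  by (simp add: space_PiM space_D)

text \<open>Clipping changes the environment only on a null set, and makes the bounds below hold for every
  \<open>\<omega>\<close>, as the covering argument and the zero-one law require.\<close>

definition clip :: "(edge \<Rightarrow> real) \<Rightarrow> edge \<Rightarrow> real" where
  "clip \<omega> e = max 0 (min b (\<omega> e))"

definition T :: "nat \<Rightarrow> (edge \<Rightarrow> real) \<Rightarrow> real" where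
  "T n \<omega> = passage_time (clip \<omega>) (0, 0) (0, int n)"

definition shift :: "(edge \<Rightarrow> real) \<Rightarrow> edge \<Rightarrow> real" where
  "shift \<omega> = (\<lambda>e. \<omega> (up_edge e))"

text \<open>By Fekete's lemma this is also the limit of the mean passage times divided by
  \<open>m\<close>. The infimum form yields \<open>mu_le\<close> and \<open>mu_ge\<close>
  directly.\<close>

definition mu :: real where
  "mu = (INF m\<in>{1..}. (\<integral>\<omega>. T m \<omega> \<partial>env) / real m)"

lemma clip_bounds: "0 \<le> clip \<omega> e" "clip \<omega> e \<le> b"
  using b_nonneg by (auto simp: clip_def)

lemma AE_env_support: "AE \<omega> in env. \<forall>e. 0 \<le> \<omega> e \<and> \<omega> e \<le> b"
  by (subst AE_all_countable) (intro allI AE_PiM_component prob_D support_D UNIV_I)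

lemma AE_clip: "AE \<omega> in env. clip \<omega> = \<omega>"
  using AE_env_support by eventually_elim (auto simp: clip_def fun_eq_iff)

lemma measurable_coordinate [measurable]: "(\<lambda>\<omega>. \<omega> e) \<in> borel_measurable env"
proof -
  have "(\<lambda>\<omega>. \<omega> e) \<in> measurable env (D e)" by measurable
  then show ?thesis by (simp cong: measurable_cong_sets add: sets_D)
qed

lemma measurable_T [measurable]: "T n \<in> borel_measurable env"
  unfolding T_def by (rule measurable_passage_time) (auto simp: clip_bounds clip_def)

lemma measurable_shift: "shift \<in> measurable env env"
  unfolding shift_def
  by (rule measurable_PiM_single') (auto simp: space_D D_up measurable_cong_sets[OF refl sets_D])

lemma distr_shift: "distr env env shift = env"
proof -
  have "inj up_edge" by (auto simp: inj_def up_edge_def up_vertex_def prod_eq_iff)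
  then show ?thesis
    using distr_PiM_reindex[of UNIV D up_edge UNIV] prob_D by (simp add: D_up shift_def[abs_def] restrict_UNIV)
qed

lemma T_shift: "T n ((shift ^^ k) \<omega>) = passage_time (clip \<omega>) (0, int k) (0, int k + int n)"
proof -
  \<comment> \<open>The claim is generalised over the base height \<open>y\<close>, since each shift
    in the induction raises the base point by one.\<close>
  have "passage_time (clip ((shift ^^ k) \<omega>)) (0, y) (0, y + int n) =
      passage_time (clip \<omega>) (0, y + int k) (0, y + int k + int n)" for y
  proof (induction k arbitrary: y)
    case (Suc k)
    have "clip (shift \<eta>) = (\<lambda>e. clip \<eta> (up_edge e))" for \<eta>
      by (simp add: clip_def shift_def fun_eq_iff)
    then show ?case using Suc[of "y + 1"] by (simp add: passage_time_up up_vertex_def add_ac)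
  qed simp
  from this[of 0] show ?thesis by (simp add: T_def)
qed

lemma T_subadditive: "T (m + n) \<omega> \<le> T m \<omega> + T n ((shift ^^ m) \<omega>)"
  unfolding T_shift
  using passage_time_triangle[of "clip \<omega>" "(0, 0)" "(0, int (m + n))" "(0, int m)", OF clip_bounds(1)]
  by (simp add: T_def)

lemma T_nonneg: "0 \<le> T n \<omega>"
  unfolding T_def by (rule passage_time_nonneg) (rule clip_bounds)

lemma T_le: "T n \<omega> \<le> b * real n"
proof -
  have "T n \<omega> \<le> (\<Sum>i<n. clip \<omega> ((0, int i), True))"
    using passage_time_vertical[of "clip \<omega>" 0 0 n, OF clip_bounds(1)] by (simp add: T_def)
  also have "\<dots> \<le> (\<Sum>i<n. b)" by (intro sum_mono clip_bounds)
  finally show ?thesis by (simp add: mult.commute)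
qed

lemma integrable_T: "integrable env (T n)"
  by (rule integrable_const_bound[where B = "b * real n"]) (auto simp: T_nonneg T_le)

section \<open>Finite modifications and the zero-one law\<close>

lemma T_finite_change:
  assumes "finite {e. \<omega> e \<noteq> \<omega>' e}"
  obtains k :: nat where "\<And>n. \<bar>T n \<omega> - T n \<omega>'\<bar> \<le> real k"
proof -
  define E where "E = {e. \<omega> e \<noteq> \<omega>' e}"
  have eq: "clip \<omega> e = clip \<omega>' e" "clip \<omega>' e = clip \<omega> e" if "e \<notin> E" for e
    using that by (simp_all add: E_def clip_def)
  have "T n \<omega> \<le> T n \<omega>' + b * real (card E)" "T n \<omega>' \<le> T n \<omega> + b * real (card E)" for n
    unfolding T_def
    by (rule passage_time_finite_change; use assms eq clip_bounds in \<open>auto simp: E_def\<close>)+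
  then have "\<bar>T n \<omega> - T n \<omega>'\<bar> \<le> b * real (card E)" for n
    using abs_le_iff by (smt (verit))
  moreover obtain k :: nat where "b * real (card E) \<le> real k"
    using real_arch_simple by blast
  ultimately show thesis using that order_trans by blast
qed

text \<open>A finite modification moves \<open>T n\<close> by at most a constant that does not
  depend on \<open>n\<close>, so it cannot destroy unboundedness. The sign \<open>s\<close> treats
  unboundedness above and below together.\<close>

lemma zero_one_unbounded:
  fixes s c :: real
  assumes s: "\<bar>s\<bar> = 1"
  defines "S \<equiv> {\<omega>. \<forall>j::nat. \<exists>n\<ge>1. s * (T n \<omega> - c * real n) > real j}"
  shows "(AE \<omega> in env. \<omega> \<in> S) \<or> (AE \<omega> in env. \<omega> \<notin> S)"
proof -
  have "S = {\<omega> \<in> space env. \<forall>j::nat. \<exists>n\<ge>1. s * (T n \<omega> - c * real n) > real j}"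
    by (simp add: S_def space_env)
  also have "\<dots> \<in> sets env" by measurable
  finally have meas: "S \<in> sets env" .
  have "prob S = 0 \<or> prob S = 1"
  proof (rule PiM_zero_one_law[OF prob_D space_D _ _ meas])
    show "infinite (UNIV :: edge set)"
      by (simp add: finite_prod)
    fix \<omega> \<omega>' assume fin: "finite {e. \<omega> e \<noteq> \<omega>' e}" and \<omega>: "\<omega> \<in> S"
    obtain k :: nat where k: "\<And>n. \<bar>T n \<omega> - T n \<omega>'\<bar> \<le> real k"
      using T_finite_change[OF fin] by blast
    have "\<exists>n\<ge>1. s * (T n \<omega>' - c * real n) > real j" for j :: nat
    proof -
      from \<omega> obtain n where n: "n \<ge> 1" "s * (T n \<omega> - c * real n) > real (j + k)"
        unfolding S_def by blast
      have "s * (T n \<omega> - c * real n) - s * (T n \<omega>' - c * real n) = s * (T n \<omega> - T n \<omega>')"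
        by (simp add: algebra_simps)
      also have "\<dots> \<le> \<bar>T n \<omega> - T n \<omega>'\<bar>"
        using s by (metis abs_ge_self abs_mult mult_1)
      finally show ?thesis using n k[of n] by (intro exI[of _ n]) auto
    qed
    then show "\<omega>' \<in> S" by (simp add: S_def)
  qed auto
  then show ?thesis
    using meas AE_in_set_eq_1[OF meas] prob_eq_0[OF meas] by auto
qed

section \<open>The time constant as an infimum of means\<close>

lemma bdd_below_mean: "bdd_below ((\<lambda>m. (\<integral>\<omega>. T m \<omega> \<partial>env) / real m) ` {1..})"
  by (rule bdd_belowI[of _ 0]) (auto intro!: divide_nonneg_nonneg Bochner_Integration.integral_nonneg T_nonneg)

lemma mu_le: "m \<ge> 1 \<Longrightarrow> mu \<le> (\<integral>\<omega>. T m \<omega> \<partial>env) / real m"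
  unfolding mu_def by (rule cINF_lower[OF bdd_below_mean]) auto

lemma mu_ge: "(\<And>m. m \<ge> 1 \<Longrightarrow> c * real m \<le> (\<integral>\<omega>. T m \<omega> \<partial>env)) \<Longrightarrow> c \<le> mu"
  unfolding mu_def by (rule cINF_greatest) (auto simp: field_simps)

lemma mu_le_if_AE_below:
  assumes "AE \<omega> in env. \<exists>n\<ge>1. T n \<omega> \<le> c * real n"
  shows "mu \<le> c"
proof (rule field_le_epsilon)
  fix \<epsilon> :: real assume "\<epsilon> > 0"
  from subadditive_expectation_le[OF measurable_shift distr_shift measurable_T T_subadditive _ assms this, of b]
  obtain N where N: "N \<ge> 1" "(\<integral>\<omega>. T N \<omega> \<partial>env) \<le> (c + \<epsilon>) * real N"
    using T_nonneg T_le by auto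
  then have "(\<integral>\<omega>. T N \<omega> \<partial>env) / real N \<le> c + \<epsilon>" by (simp add: field_simps)
  with mu_le[OF N(1)] show "mu \<le> c + \<epsilon>" by simp
qed

lemma T_mult_le_sum: "T (k * m) \<omega> \<le> (\<Sum>j<k. T m ((shift ^^ (j * m)) \<omega>))"
proof (induction k)
  case 0
  show ?case using T_le[of 0 \<omega>] by simp
next
  case (Suc k)
  then show ?case using T_subadditive[of "k * m" m \<omega>] by (simp add: add.commute)
qed

text \<open>The greedy bound, applied to the additive process of minus the sums of block passage times,
  takes the place of the ergodic theorem.\<close>

lemma AE_above_le_mean:
  assumes above: "AE \<omega> in env. \<forall>j::nat. \<exists>n\<ge>1. T n \<omega> - c * real n > real j" and "m \<ge> 1"
  shows "c * real m \<le> (\<integral>\<omega>. T m \<omega> \<partial>env)"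
proof (rule field_le_epsilon)
  fix \<epsilon> :: real assume \<epsilon>: "\<epsilon> > 0"
  define \<theta> where "\<theta> = shift ^^ m"
  have \<theta>: "\<theta> \<in> measurable env env" "distr env env \<theta> = env"
  proof -
    show *: "\<theta> \<in> measurable env env"
      unfolding \<theta>_def by (rule measurable_compose_n) (rule measurable_shift)
    show "distr env env \<theta> = env"
      unfolding \<theta>_def
    proof (induction m)
      case 0
      show ?case using distr_id[of env] by (simp add: id_def)
    next
      case (Suc m)
      have "distr env env (shift \<circ> (shift ^^ m)) = distr (distr env env (shift ^^ m)) env shift"
        by (rule distr_distr[symmetric]) (auto intro: measurable_shift measurable_compose_n)
      then show ?case using Suc distr_shift by (simp add: comp_def)
    qed
  qed
  have \<theta>_pow: "\<theta> ^^ j = shift ^^ (j * m)" for j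
    by (simp add: \<theta>_def funpow_mult mult.commute)
  define f where "f n \<omega> = - (\<Sum>j<n. T m ((\<theta> ^^ j) \<omega>))" for n \<omega>
  have f_meas: "f n \<in> borel_measurable env" for n
    unfolding f_def using measurable_compose_n[OF \<theta>(1)] by measurable
  have f_add: "f (n + k) \<omega> \<le> f n \<omega> + f k ((\<theta> ^^ n) \<omega>)" for n k \<omega>
  proof -
    have "(\<Sum>j<n + k. T m ((\<theta> ^^ j) \<omega>)) = (\<Sum>j<n. T m ((\<theta> ^^ j) \<omega>)) + (\<Sum>j<k. T m ((\<theta> ^^ (j + n)) \<omega>))"
      by (induction k) (simp_all add: add_ac)
    then show ?thesis by (simp add: f_def funpow_add)
  qed
  have f_bound: "\<bar>f n \<omega>\<bar> \<le> (b * real m) * real n" for n \<omega>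
  proof -
    have "\<bar>f n \<omega>\<bar> = (\<Sum>j<n. T m ((\<theta> ^^ j) \<omega>))"
      by (simp add: f_def sum_nonneg T_nonneg)
    also have "\<dots> \<le> (\<Sum>j<n. b * real m)" by (intro sum_mono T_le)
    finally show ?thesis by (simp add: mult.commute)
  qed
  have "AE \<omega> in env. \<exists>n\<ge>1. f n \<omega> \<le> (- c * real m) * real n"
    using above
  proof eventually_elim
    case (elim \<omega>)
    \<comment> \<open>\<open>J\<close> absorbs the last \<open>n mod m\<close> steps when
      \<open>n\<close> is rounded down to a multiple of \<open>m\<close>: they cost at most
      \<open>b * real m\<close> in passage time and \<open>\<bar>c\<bar> * real m\<close> in drift.
      This is why excesses beyond every constant are assumed.\<close>
    obtain J :: nat where J: "real J \<ge> (b + \<bar>c\<bar>) * real m"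
      using real_arch_simple by blast
    from elim obtain n where n: "n \<ge> 1" "T n \<omega> - c * real n > real J" by blast
    define k where "k = n div m"
    have nk: "n = k * m + n mod m" and r: "n mod m < m" using \<open>m \<ge> 1\<close> by (auto simp: k_def)
    have rm: "b * real (n mod m) \<le> b * real m" "\<bar>c\<bar> * real (n mod m) \<le> \<bar>c\<bar> * real m"
      using r b_nonneg by (auto intro!: mult_left_mono)
    have "T n \<omega> \<le> T (k * m) \<omega> + b * real (n mod m)"
      using T_subadditive[of "k * m" "n mod m" \<omega>] T_le[of "n mod m" "(shift ^^ (k * m)) \<omega>"] nk by simp
    moreover have "c * real n = c * real (k * m) + c * real (n mod m)"
      by (subst nk) (simp only: of_nat_add distrib_left)
    moreover have "- (\<bar>c\<bar> * real (n mod m)) \<le> c * real (n mod m)"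
      by (metis abs_ge_minus_self abs_mult abs_of_nat minus_le_iff)
    ultimately have *: "c * real (k * m) < T (k * m) \<omega>"
      using n(2) J rm by (simp add: algebra_simps)
    \<comment> \<open>For \<open>k = 0\<close> the strict inequality would say that
      \<open>T 0\<close> is positive.\<close>
    then have "k \<ge> 1" using T_le[of 0 \<omega>] by (cases k) auto
    moreover have "f k \<omega> \<le> (- c * real m) * real k"
      using * T_mult_le_sum[of k m \<omega>] by (simp add: f_def \<theta>_pow algebra_simps)
    ultimately show ?case by blast
  qed
  from subadditive_expectation_le[OF \<theta> f_meas f_add f_bound this \<epsilon>]
  obtain N where N: "N \<ge> 1" "(\<integral>\<omega>. f N \<omega> \<partial>env) \<le> (- c * real m + \<epsilon>) * real N" by blast
  have int: "integrable env (\<lambda>\<omega>. T m ((\<theta> ^^ j) \<omega>))" for j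
    by (rule integrable_const_bound[where B = "b * real m"])
      (use measurable_compose_n[OF \<theta>(1)] in \<open>auto simp: T_nonneg T_le\<close>)
  have "(\<integral>\<omega>. f N \<omega> \<partial>env) = - (real N * (\<integral>\<omega>. T m \<omega> \<partial>env))"
    using int by (simp add: f_def integral_measure_preserving_funpow[OF \<theta> measurable_T])
  with N have "real N * (c * real m) \<le> real N * ((\<integral>\<omega>. T m \<omega> \<partial>env) + \<epsilon>)"
    by (simp add: algebra_simps)
  with N show "c * real m \<le> (\<integral>\<omega>. T m \<omega> \<partial>env) + \<epsilon>" by simp
qed

section \<open>Almost sure limits\<close>

lemma AE_T_ge:
  assumes "c < mu"
  shows "AE \<omega> in env. \<exists>j::nat. \<forall>n\<ge>1. c * real n - real j \<le> T n \<omega>"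
proof -
  let ?S = "{\<omega>. \<forall>j::nat. \<exists>n\<ge>1. (- 1) * (T n \<omega> - c * real n) > real j}"
  \<comment> \<open>By the zero-one law it is enough to refute that
    \<open>T n \<omega> - c * real n\<close> is almost surely unbounded below. The threshold
    \<open>j = 0\<close> already leads to \<open>mu \<le> c\<close>.\<close>
  have "\<not> (AE \<omega> in env. \<omega> \<in> ?S)"
  proof
    assume "AE \<omega> in env. \<omega> \<in> ?S"
    then have "AE \<omega> in env. \<exists>n\<ge>1. T n \<omega> \<le> c * real n"
    proof eventually_elim
      case (elim \<omega>)
      then obtain n where "n \<ge> 1" "(- 1) * (T n \<omega> - c * real n) > real 0" by blast
      then show ?case by (intro exI[of _ n]) simp
    qed
    from mu_le_if_AE_below[OF this] assms show False by simp
  qed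
  with zero_one_unbounded[of "- 1" c] have "AE \<omega> in env. \<omega> \<notin> ?S" by auto
  then show ?thesis
  proof eventually_elim
    case (elim \<omega>)
    then obtain j :: nat where "\<And>n. n \<ge> 1 \<Longrightarrow> (- 1) * (T n \<omega> - c * real n) \<le> real j"
      by (auto simp: not_less)
    then show ?case by (intro exI[of _ j]) (auto simp: algebra_simps)
  qed
qed

lemma AE_T_le:
  assumes "mu < c"
  shows "AE \<omega> in env. \<exists>j::nat. \<forall>n\<ge>1. T n \<omega> \<le> c * real n + real j"
proof -
  let ?S = "{\<omega>. \<forall>j::nat. \<exists>n\<ge>1. 1 * (T n \<omega> - c * real n) > real j}"
  have "\<not> (AE \<omega> in env. \<omega> \<in> ?S)"
  proof
    assume "AE \<omega> in env. \<omega> \<in> ?S"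
    then have "AE \<omega> in env. \<forall>j::nat. \<exists>n\<ge>1. T n \<omega> - c * real n > real j" by simp
    from mu_ge[OF AE_above_le_mean[OF this]] assms show False by simp
  qed
  with zero_one_unbounded[of 1 c] have "AE \<omega> in env. \<omega> \<notin> ?S" by auto
  then show ?thesis
  proof eventually_elim
    case (elim \<omega>)
    then obtain j :: nat where "\<And>n. n \<ge> 1 \<Longrightarrow> 1 * (T n \<omega> - c * real n) \<le> real j"
      by (auto simp: not_less)
    then show ?case by (intro exI[of _ j]) (auto simp: algebra_simps)
  qed
qed

text \<open>The additive constants from the two one-sided bounds vanish after division by
  \<open>n\<close>. Letting the slack run through the sequence \<open>\<epsilon> k\<close> leaves
  only countably many exceptional null sets.\<close>

lemma AE_T_converges: "AE \<omega> in env. (\<lambda>n. T n \<omega> / real n) \<longlonglongrightarrow> mu"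
proof -
  define \<epsilon> where "\<epsilon> k = inverse (real (Suc k))" for k
  have "AE \<omega> in env. \<forall>k. (\<exists>j::nat. \<forall>n\<ge>1. (mu - \<epsilon> k) * real n - real j \<le> T n \<omega>) \<and>
      (\<exists>j::nat. \<forall>n\<ge>1. T n \<omega> \<le> (mu + \<epsilon> k) * real n + real j)"
    by (subst AE_all_countable) (intro allI AE_conjI AE_T_ge AE_T_le; simp add: \<epsilon>_def)
  then show ?thesis
  proof eventually_elim
    case (elim \<omega>)
    show ?case
    proof (rule LIMSEQ_I)
      fix r :: real assume "r > 0"
      then obtain k where k: "\<epsilon> k < r / 2"
        unfolding \<epsilon>_def using reals_Archimedean[of "r / 2"] by auto
      from elim obtain i j :: nat where ij: "\<And>n. n \<ge> 1 \<Longrightarrow> (mu - \<epsilon> k) * real n - real i \<le> T n \<omega>"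
        "\<And>n. n \<ge> 1 \<Longrightarrow> T n \<omega> \<le> (mu + \<epsilon> k) * real n + real j" by metis
      obtain N :: nat where N: "real N > 2 * real (i + j) / r" using reals_Archimedean2 by blast
      show "\<exists>no. \<forall>n\<ge>no. norm (T n \<omega> / real n - mu) < r"
      proof (intro exI[of _ "Suc N"] allI impI)
        fix n assume n: "n \<ge> Suc N"
        have "2 * real (i + j) < r * real N" using N \<open>r > 0\<close> by (simp add: field_simps)
        also have "\<dots> \<le> r * real n" using n \<open>r > 0\<close> by simp
        finally have 1: "real (i + j) < r / 2 * real n" by simp
        have 2: "\<epsilon> k * real n < r / 2 * real n" using k n by simp
        have "\<bar>T n \<omega> - mu * real n\<bar> < r * real n"
        proof -
          have "mu * real n - \<epsilon> k * real n - real i \<le> T n \<omega>"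
            "T n \<omega> \<le> mu * real n + \<epsilon> k * real n + real j"
            using ij[of n] n by (auto simp: left_diff_distrib distrib_right)
          with 1 2 have "T n \<omega> - mu * real n < r / 2 * real n + r / 2 * real n"
            "mu * real n - T n \<omega> < r / 2 * real n + r / 2 * real n"
            unfolding of_nat_add by linarith+
          then show ?thesis by (simp add: abs_less_iff)
        qed
        then show "norm (T n \<omega> / real n - mu) < r"
          using n by (simp add: field_simps abs_less_iff)
      qed
    qed
  qed
qed

lemma AE_passage_time_converges:
  "AE \<omega> in env. (\<lambda>n. passage_time \<omega> (0, 0) (scale n e2) / real n) \<longlonglongrightarrow> mu"
  using AE_T_converges AE_clip
proof eventually_elim
  case (elim \<omega>)
  then show ?case by (simp add: T_def scale_def e2_def)
qed

lemma passage_time_converges_in_measure: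
  assumes "\<epsilon> > 0"
  shows "(\<lambda>n. measure env {\<omega> \<in> space env. \<bar>passage_time \<omega> (0, 0) (scale n e2) / real n - mu\<bar> > \<epsilon>})
    \<longlonglongrightarrow> 0"
proof -
  define X where "X n = {\<omega> \<in> space env. \<bar>passage_time \<omega> (0, 0) (scale n e2) / real n - mu\<bar> > \<epsilon>}" for n
  have [measurable]: "X n \<in> sets env" for n
    unfolding X_def using measurable_passage_time[of "\<lambda>\<omega>. \<omega>" env "(0, 0)" "scale n e2"] by measurable
  have "(\<lambda>n. \<integral>\<omega>. (indicator (X n) \<omega> :: real) \<partial>env) \<longlonglongrightarrow> (\<integral>\<omega>. 0 \<partial>env)"
  proof (rule integral_dominated_convergence)
    show "AE \<omega> in env. (\<lambda>n. indicator (X n) \<omega>) \<longlonglongrightarrow> (0::real)"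
      using AE_passage_time_converges
    proof eventually_elim
      case (elim \<omega>)
      from tendstoD[OF elim assms]
      have "eventually (\<lambda>n. indicator (X n) \<omega> = (0::real)) sequentially"
        by eventually_elim (simp add: X_def dist_real_def)
      then show ?case by (rule tendsto_eventually)
    qed
    show "integrable env (\<lambda>_. 1::real)" by simp
  qed (auto split: split_indicator)
  then show ?thesis by (simp add: X_def[symmetric])
qed

section \<open>Exponential moments and a lower bound for the time constant\<close>

lemma expectation_prod_coordinates:
  fixes g :: "edge \<Rightarrow> real \<Rightarrow> real"
  assumes "finite E" and g: "\<And>e. integrable (D e) (g e)"
  shows "integrable env (\<lambda>\<omega>. \<Prod>e\<in>E. g e (\<omega> e))"
    and "(\<integral>\<omega>. (\<Prod>e\<in>E. g e (\<omega> e)) \<partial>env) = (\<Prod>e\<in>E. \<integral>w. g e w \<partial>D e)"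
proof -
  note [measurable] = borel_measurable_integrable[OF g]
  have D_eq: "D e = distr env (D e) (\<lambda>\<omega>. \<omega> e)" for e
    by (rule distr_PiM_component[symmetric]) (auto intro: prob_D)
  have "indep_vars D (\<lambda>e \<omega>. \<omega> e) E"
    using indep_vars_PiM_coordinates[of D UNIV, OF prob_D] by (rule indep_vars_subset) auto
  from indep_vars_compose2[OF this, of g "\<lambda>_. borel"]
  have indep: "indep_vars (\<lambda>_. borel) (\<lambda>e \<omega>. g e (\<omega> e)) E" by simp
  have int: "integrable env (\<lambda>\<omega>. g e (\<omega> e))" for e
    using g[of e] by (subst (asm) D_eq) (simp add: integrable_distr_eq)
  have exp: "(\<integral>\<omega>. g e (\<omega> e) \<partial>env) = (\<integral>w. g e w \<partial>D e)" for e
    using integral_distr[of "\<lambda>\<omega>. \<omega> e" env "D e" "g e"] D_eq[of e] by simp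
  show "integrable env (\<lambda>\<omega>. \<Prod>e\<in>E. g e (\<omega> e))"
    by (rule indep_vars_integrable[OF \<open>finite E\<close> indep int])
  show "(\<integral>\<omega>. (\<Prod>e\<in>E. g e (\<omega> e)) \<partial>env) = (\<Prod>e\<in>E. \<integral>w. g e w \<partial>D e)"
    using indep_vars_lebesgue_integral[OF \<open>finite E\<close> indep int] by (simp add: exp)
qed

text \<open>A first-moment bound. The \<open>m\<close> weights on a self-avoiding walk of length
  \<open>m\<close> are independent, so the walk contributes \<open>r ^ m\<close>; there are at most
  \<open>4 ^ m\<close> such walks. Hence the mean of \<open>exp (- T m \<omega>)\<close> is at most
  \<open>exp (- real m)\<close>, and Jensen's inequality passes to the mean of
  \<open>T m\<close>.\<close>

lemma mu_ge_one_if_exp_moment: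
  assumes r: "\<And>e. (\<integral>w. exp (- w) \<partial>D e) = r" and "4 * r \<le> exp (- 1)"
  shows "1 \<le> mu"
proof (rule mu_ge)
  fix m :: nat
  have "0 \<le> r" unfolding r[symmetric, of undefined] by (rule Bochner_Integration.integral_nonneg) simp
  have int_exp: "integrable (D e) (\<lambda>w. exp (- w))" for e
  proof -
    interpret De: prob_space "D e" by (rule prob_D)
    have "(\<lambda>w. exp (- w)) \<in> borel_measurable (D e)"
      by (simp add: measurable_cong_sets[OF sets_D refl])
    moreover have "AE w in D e. norm (exp (- w)) \<le> 1"
      using support_D[of e] by eventually_elim simp
    ultimately show ?thesis by (intro De.integrable_const_bound[where B = 1])
  qed
  define W where "W = {p \<in> walks (0, 0) m. distinct p}"
  have finW: "finite W" and "card W \<le> 4 ^ m"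
    using card_walks[of "(0, 0)" m] card_mono[of "walks (0, 0) m" W] by (auto simp: W_def)
  have walk: "exp (- path_weight \<omega> p) = (\<Prod>e\<in>set (path_edges p). exp (- \<omega> e))"
    "card (set (path_edges p)) = m" if "p \<in> W" for p and \<omega> :: "edge \<Rightarrow> real"
  proof -
    from that have d: "distinct (path_edges p)" "length p = Suc m"
      by (auto simp: W_def walks_def distinct_path_edges)
    then show "exp (- path_weight \<omega> p) = (\<Prod>e\<in>set (path_edges p). exp (- \<omega> e))"
      by (simp add: path_weight_eq sum_list_distinct_conv_sum_set exp_sum flip: sum_negf)
    show "card (set (path_edges p)) = m"
      using d by (simp add: distinct_card length_path_edges)
  qed
  have int: "integrable env (\<lambda>\<omega>. exp (- path_weight \<omega> p))"
    and val: "(\<integral>\<omega>. exp (- path_weight \<omega> p) \<partial>env) = r ^ m" if "p \<in> W" for p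
    using expectation_prod_coordinates[of "set (path_edges p)" "\<lambda>_ w. exp (- w)"] int_exp walk[OF that]
    by (simp_all add: r)
  have int_T: "integrable env (\<lambda>\<omega>. exp (- T m \<omega>))"
    by (rule integrable_const_bound[where B = 1]) (auto simp: T_nonneg)
  define c where "c = (\<integral>\<omega>. T m \<omega> \<partial>env)"
  \<comment> \<open>Jensen's inequality by hand: the integrand on the right is the tangent line of
    \<open>exp (- t)\<close> at the mean \<open>t = c\<close>.\<close>
  have "exp (- c) = (\<integral>\<omega>. exp (- c) * (1 + c - T m \<omega>) \<partial>env)"
    using integrable_T[of m] by (simp add: c_def prob_space)
  also have "\<dots> \<le> (\<integral>\<omega>. exp (- T m \<omega>) \<partial>env)"
  proof (rule integral_mono[OF _ int_T])
    fix \<omega>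
    have "exp (- c) * (1 + (c - T m \<omega>)) \<le> exp (- c) * exp (c - T m \<omega>)"
      by (intro mult_left_mono exp_ge_add_one_self) auto
    also have "\<dots> = exp (- T m \<omega>)" by (simp flip: exp_add)
    finally show "exp (- c) * (1 + c - T m \<omega>) \<le> exp (- T m \<omega>)" by (simp add: algebra_simps)
  qed (use integrable_T[of m] in auto)
  also have "\<dots> \<le> (\<integral>\<omega>. (\<Sum>p\<in>W. exp (- path_weight \<omega> p)) \<partial>env)"
  proof (rule integral_mono_AE[OF int_T])
    show "integrable env (\<lambda>\<omega>. \<Sum>p\<in>W. exp (- path_weight \<omega> p))" using int by auto
    show "AE \<omega> in env. exp (- T m \<omega>) \<le> (\<Sum>p\<in>W. exp (- path_weight \<omega> p))"
      using AE_clip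
    proof eventually_elim
      case (elim \<omega>)
      show ?case
        using exp_passage_time_le[of "clip \<omega>" m, OF clip_bounds(1)] by (simp add: T_def W_def elim)
    qed
  qed
  also have "\<dots> = real (card W) * r ^ m" using int val by simp
  also have "\<dots> \<le> 4 ^ m * r ^ m"
    using \<open>card W \<le> 4 ^ m\<close> \<open>0 \<le> r\<close> by (intro mult_right_mono) (auto simp flip: of_nat_le_iff)
  also have "\<dots> \<le> exp (- 1) ^ m"
    using power_mono[OF assms(2), of m] \<open>0 \<le> r\<close> by (simp add: power_mult_distrib)
  also have "\<dots> = exp (- real m)" using exp_of_nat_mult[of m "- 1 :: real"] by simp
  finally show "1 * real m \<le> (\<integral>\<omega>. T m \<omega> \<partial>env)" by (simp add: c_def)
qed

end

section \<open>The example\<close>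

text \<open>A \<open>pmf\<close> measures all subsets; pushing it forward to \<open>borel\<close>
  gives the sigma-algebra that \<open>distr_nonneg\<close> demands.\<close>

definition two_point :: "real \<Rightarrow> real \<Rightarrow> real \<Rightarrow> real measure" where
  "two_point p x y = distr (measure_pmf (bernoulli_pmf p)) borel (\<lambda>b. if b then x else y)"

lemma sets_two_point [simp, measurable_cong]: "sets (two_point p x y) = sets borel"
  by (simp add: two_point_def)

lemma prob_space_two_point: "prob_space (two_point p x y)"
  unfolding two_point_def by (intro prob_space.prob_space_distr prob_space_measure_pmf) simp

lemma AE_two_point:
  assumes [measurable]: "Measurable.pred borel P" and "P x" "P y"
  shows "AE w in two_point p x y. P w"
  unfolding two_point_def by (subst AE_distr_iff) (auto simp: assms)

lemma integral_two_point:
  fixes f :: "real \<Rightarrow> real"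
  assumes [measurable]: "f \<in> borel_measurable borel" and "0 \<le> p" "p \<le> 1"
  shows "(\<integral>w. f w \<partial>two_point p x y) = p * f x + (1 - p) * f y"
  unfolding two_point_def using assms by (subst integral_distr) auto

lemma distr_nonneg_two_point:
  assumes "0 \<le> x" "0 \<le> y"
  shows "distr_nonneg (two_point p x y)"
  unfolding distr_nonneg_def
  by (intro conjI prob_space_two_point sets_two_point prob_space.emeasure_eq_1_AE AE_two_point)
    (auto simp: assms)

lemma bounded_support_two_point:
  assumes "0 \<le> x" "0 \<le> y"
  shows "bounded_support (two_point p x y)"
  unfolding bounded_support_def
  by (intro exI[of _ "max x y"] prob_space_two_point prob_space.emeasure_eq_1_AE AE_two_point)
    (auto simp: assms)

text \<open>The point \<open>x\<close> has mass \<open>p\<close>, strictly between 0 and 1, whereas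
  a point mass gives it 0 or 1.\<close>

lemma nondegenerate_two_point:
  assumes p: "0 < p" "p < 1" and "x \<noteq> y"
  shows "nondegenerate (two_point p x y)"
  unfolding nondegenerate_def
proof
  assume "\<exists>z. two_point p x y = return borel z"
  then obtain z where z: "two_point p x y = return borel z" ..
  have "(\<integral>w. indicator {x} w \<partial>two_point p x y) = p"
    using p \<open>x \<noteq> y\<close> by (subst integral_two_point) auto
  moreover have "(\<integral>w. (indicator {x} w :: real) \<partial>return borel z) = indicator {x} z"
    by (rule integral_return) auto
  ultimately have "indicator {x} z = p" by (simp only: z)
  then show False using p by (cases "z = x") auto
qed

section \<open>The three concrete environments\<close>

lemma minus_edge_up: "minus_edge (up_edge e) = minus_edge e"
proof (cases e)
  case (Pair u d)
  then show ?thesis by (cases d) (simp_all add: minus_edge_def up_edge_def up_vertex_def)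
qed

text \<open>Two demands meet here. Three fast edges cost \<open>1/2\<close>, so a detour with two
  horizontal edges of weight near 1 beats three vertical edges of weight near 1. On the other hand
  \<open>1/32\<close> is small and 5 large enough for four times the mean of
  \<open>exp (- w)\<close> to stay below \<open>exp (- 1)\<close>.\<close>

definition F_plus :: "real measure" where "F_plus = two_point (1/32) (1/6) 5"

text \<open>The spread makes the law non-degenerate, yet three edges exceed 3 by at most
  \<open>3/10^6\<close>, while a detour saves at least \<open>1/2\<close> with probability
  \<open>(1/32)^3\<close>, a mean gain of about \<open>15/10^6\<close> per block.\<close>

definition F_minus :: "real measure" where "F_minus = two_point (1/2) 1 (1 + 1/10^6)"

lemma AE_F_plus: "AE w in F_plus. 0 \<le> w \<and> w \<le> 5"
  unfolding F_plus_def by (rule AE_two_point) simp_all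

lemma AE_F_minus: "AE w in F_minus. 1 \<le> w \<and> w \<le> 1 + 1/10^6"
  unfolding F_minus_def by (rule AE_two_point) simp_all

lemma AE_F_minus': "AE w in F_minus. 0 \<le> w \<and> w \<le> 5"
  using AE_F_minus by eventually_elim simp

lemma sets_F [simp, measurable_cong]:
  "sets F_plus = sets borel" "sets F_minus = sets borel"
  by (simp_all add: F_plus_def F_minus_def)

lemma prob_F: "prob_space F_plus" "prob_space F_minus"
  by (simp_all add: F_plus_def F_minus_def prob_space_two_point)

interpretation plus: vertically_stationary_fpp "\<lambda>_. F_plus" 5
  by (rule vertically_stationary_fpp.intro) (rule prob_F sets_F AE_F_plus refl | simp)+

interpretation minus: vertically_stationary_fpp "\<lambda>_. F_minus" 5
  by (rule vertically_stationary_fpp.intro) (rule prob_F sets_F AE_F_minus' refl | simp)+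

definition F_mixed :: "edge \<Rightarrow> real measure" where
  "F_mixed e = (if minus_edge e then F_minus else F_plus)"

interpretation mixed: vertically_stationary_fpp F_mixed 5
proof (rule vertically_stationary_fpp.intro)
  fix e
  have "F_mixed e \<in> {F_minus, F_plus}" by (simp add: F_mixed_def)
  then show "prob_space (F_mixed e)" "sets (F_mixed e) = sets borel"
    "AE w in F_mixed e. 0 \<le> w \<and> w \<le> 5"
    using prob_F sets_F AE_F_plus AE_F_minus' by (metis insertE singletonD)+
  show "F_mixed (up_edge e) = F_mixed e" by (simp add: F_mixed_def minus_edge_up)
qed simp

section \<open>The homogeneous time constants are at least one\<close>

lemma mu_plus_ge: "1 \<le> plus.mu"
proof (rule plus.mu_ge_one_if_exp_moment)
  show "(\<integral>w. exp (- w) \<partial>F_plus) = 1/32 * exp (- (1/6)) + 31/32 * exp (- 5)"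
    unfolding F_plus_def by (subst integral_two_point) auto
  have "(2::real) ^ 5 \<le> exp 1 ^ 5" using exp_ge_add_one_self[of "1::real"] by (intro power_mono) auto
  then have "32 \<le> exp (5 :: real)"
    using exp_of_nat_mult[of 5 "1 :: real"] by simp
  then have "exp (- 5 :: real) \<le> 1/32"
    by (simp add: exp_minus field_simps)
  moreover have "exp (- (1/6) :: real) \<le> 1" by simp
  moreover have "exp (- 1 :: real) \<ge> 1/3" using exp_le by (simp add: exp_minus field_simps)
  \<comment> \<open>The left side is at most \<open>1/8 + 31/256 = 63/256\<close>, which is below
    \<open>1/3\<close>.\<close>
  ultimately have "exp (- (1/6)) / 8 + 31 * exp (- 5) / 8 \<le> exp (- 1 :: real)" by linarith
  then show "4 * (1/32 * exp (- (1/6)) + 31/32 * exp (- 5)) \<le> exp (- 1 :: real)"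
    by (simp add: distrib_left)
qed

lemma mu_minus_ge: "1 \<le> minus.mu"
proof (rule minus.mu_ge)
  fix m :: nat
  have "AE w in F_minus. 1 \<le> w" using AE_F_minus by eventually_elim simp
  then have "AE \<omega> in PiM UNIV (\<lambda>_. F_minus). \<forall>e::edge. 1 \<le> \<omega> e"
    by (subst AE_all_countable) (intro allI AE_PiM_component prob_F UNIV_I)
  then have "AE \<omega> in PiM UNIV (\<lambda>_. F_minus). real m \<le> minus.T m \<omega>"
    using minus.AE_clip
  proof eventually_elim
    case (elim \<omega>)
    then have "real m \<le> passage_time \<omega> (0, 0) (0, int m)" by (intro passage_time_ge_length) blast
    with elim show ?case by (simp add: minus.T_def)
  qed
  then show "1 * real m \<le> (\<integral>\<omega>. minus.T m \<omega> \<partial>PiM UNIV (\<lambda>_. F_minus))"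
    by (simp add: minus.integral_ge_const[OF minus.integrable_T])
qed

section \<open>Detours along the interface\<close>

definition fast :: "nat \<Rightarrow> edge set" where
  "fast j = (\<lambda>i. ((0, 3 * int j + int i), True)) ` {..<3}"

text \<open>The product is 1 when all three edges of the block are fast and 0 otherwise. In a fast
  block the route crosses to the column \<open>x = 0\<close> and back at cost
  \<open>2 * d + 1/2\<close> instead of \<open>3 * d\<close>. The crossing edges have an endpoint on
  the negative side, hence weight at most \<open>d\<close>. The leading \<open>2 * d\<close> pays
  for leaving the origin to the column \<open>x = -1\<close> and for the final return.\<close>

lemma mixed_passage_time_le:
  assumes nonneg: "\<And>e. 0 \<le> \<omega> e" and minus: "\<And>e. minus_edge e \<Longrightarrow> \<omega> e \<le> d"
  shows "passage_time \<omega> (0, 0) (0, int (3 * k)) \<le>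
    2 * d + (\<Sum>j<k. 3 * d - (d - 1/2) * (\<Prod>e\<in>fast j. indicator {..1/6} (\<omega> e)))"
proof -
  note triangle = passage_time_triangle[of \<omega>, OF nonneg]
  have left: "passage_time \<omega> (0, y) (-1, y) \<le> d" and right: "passage_time \<omega> (-1, y) (0, y) \<le> d" for y
    using passage_time_edge[of \<omega>, OF nonneg, of "(0, y)" "(-1, y)"]
      passage_time_edge[of \<omega>, OF nonneg, of "(-1, y)" "(0, y)"]
      minus[of "((-1, y), False)"] edge_betw_simps(2,3)[of "-1" y]
    by (auto simp: adj_def minus_edge_def)
  have block: "passage_time \<omega> (-1, 3 * int j) (-1, 3 * int j + 3)
      \<le> 3 * d - (d - 1/2) * (\<Prod>e\<in>fast j. indicator {..1/6} (\<omega> e))" for j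
  proof (cases "\<forall>e\<in>fast j. \<omega> e \<le> 1/6")
    case True
    have "passage_time \<omega> (0, 3 * int j) (0, 3 * int j + 3) \<le> (\<Sum>i<3. \<omega> ((0, 3 * int j + int i), True))"
      using passage_time_vertical[of \<omega> 0 "3 * int j" 3, OF nonneg] by simp
    also have "\<dots> \<le> (\<Sum>i<(3::nat). 1/6)" using True by (intro sum_mono) (auto simp: fast_def)
    finally have "passage_time \<omega> (0, 3 * int j) (0, 3 * int j + 3) \<le> 1/2" by simp
    moreover have "passage_time \<omega> (-1, 3 * int j) (-1, 3 * int j + 3) \<le>
        passage_time \<omega> (-1, 3 * int j) (0, 3 * int j) + passage_time \<omega> (0, 3 * int j) (0, 3 * int j + 3)
          + passage_time \<omega> (0, 3 * int j + 3) (-1, 3 * int j + 3)"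
      using triangle[of "(-1, 3 * int j)" "(-1, 3 * int j + 3)" "(0, 3 * int j)"]
        triangle[of "(0, 3 * int j)" "(-1, 3 * int j + 3)" "(0, 3 * int j + 3)"] by linarith
    moreover have "(\<Prod>e\<in>fast j. indicator {..1/6} (\<omega> e)) = (1::real)"
      using True by (intro prod.neutral) auto
    ultimately show ?thesis
      using left[of "3 * int j + 3"] right[of "3 * int j"] by simp
  next
    case False
    then obtain e where "e \<in> fast j" "indicator {..1/6} (\<omega> e) = (0::real)" by auto
    then have "(\<Prod>e\<in>fast j. indicator {..1/6} (\<omega> e)) = (0::real)"
      by (intro prod_zero) (auto simp: fast_def)
    moreover have "passage_time \<omega> (-1, 3 * int j) (-1, 3 * int j + 3)
        \<le> (\<Sum>i<3. \<omega> ((-1, 3 * int j + int i), True))"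
      using passage_time_vertical[of \<omega> "-1" "3 * int j" 3, OF nonneg] by simp
    moreover have "\<dots> \<le> (\<Sum>i<(3::nat). d)" by (intro sum_mono minus) (simp add: minus_edge_def)
    ultimately show ?thesis by simp
  qed
  have "passage_time \<omega> (-1, 0) (-1, 3 * int k) \<le>
      (\<Sum>j<k. 3 * d - (d - 1/2) * (\<Prod>e\<in>fast j. indicator {..1/6} (\<omega> e)))"
  proof (induction k)
    case 0
    show ?case using passage_time_vertical[of \<omega> "-1" 0 0, OF nonneg] by simp
  next
    case (Suc k)
    then show ?case
      using triangle[of "(-1, 0)" "(-1, 3 * int k + 3)" "(-1, 3 * int k)"] block[of k]
      by (simp add: algebra_simps)
  qed
  then show ?thesis
    using triangle[of "(0, 0)" "(0, 3 * int k)" "(-1, 0)"] left[of 0] right[of "3 * int k"]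
      triangle[of "(-1, 0)" "(0, 3 * int k)" "(-1, 3 * int k)"]
    by simp
qed

lemma mu_mixed_less: "mixed.mu < 1"
proof -
  define d :: real where "d = 1 + 1/10^6"
  \<comment> \<open>The number of blocks must let the total gain beat the end cost
    \<open>2 * d\<close>: the net gain is about \<open>12/10^6\<close> per block, so
    \<open>10^6\<close> blocks gain about 12.\<close>
  obtain k :: nat where k: "k \<ge> 1" "real k = 10^6"
    by (rule that[of "10^6"]) simp_all
  let ?g = "\<lambda>j \<omega>. \<Prod>e\<in>fast j. indicator {..1/6} (\<omega> e) :: real"
  have int_ind: "integrable (F_mixed e) (indicator {..1/6 :: real} :: real \<Rightarrow> real)" for e
  proof -
    interpret Fe: prob_space "F_mixed e" by (rule mixed.prob_D)
    have "(indicator {..1/6 :: real} :: real \<Rightarrow> real) \<in> borel_measurable (F_mixed e)"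
      by (simp add: measurable_cong_sets[OF mixed.sets_D refl])
    then show ?thesis by (intro Fe.integrable_const_bound[where B = 1]) (auto split: split_indicator)
  qed
  have fin: "finite (fast j)" and card: "card (fast j) = 3" for j
    by (auto simp: fast_def card_image inj_on_def)
  have int_g: "integrable (PiM UNIV F_mixed) (?g j)" for j
    by (rule mixed.expectation_prod_coordinates(1)[OF fin int_ind])
  have "(\<integral>w. indicator {..1/6} w \<partial>F_mixed e) = (1/32 :: real)" if "e \<in> fast j" for e j
  proof -
    have "F_mixed e = F_plus" using that by (auto simp: fast_def F_mixed_def minus_edge_def)
    then show ?thesis unfolding F_plus_def by (simp only:) (subst integral_two_point; simp)
  qed
  then have "(\<Prod>e\<in>fast j. \<integral>w. indicator {..1/6} w \<partial>F_mixed e) = (\<Prod>e\<in>fast j. (1/32 :: real))" for j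
    by (rule prod.cong[OF refl])
  then have E_g: "(\<integral>\<omega>. ?g j \<omega> \<partial>PiM UNIV F_mixed) = (1/32) ^ 3" for j
    unfolding mixed.expectation_prod_coordinates(2)[OF fin int_ind] prod_constant card .
  have "AE \<omega> in PiM UNIV F_mixed. \<forall>e. minus_edge e \<longrightarrow> \<omega> e \<le> d"
  proof (subst AE_all_countable, intro allI)
    fix e
    have "AE w in F_mixed e. minus_edge e \<longrightarrow> w \<le> d"
    proof (cases "minus_edge e")
      case True
      then have *: "F_mixed e = F_minus" by (simp add: F_mixed_def)
      show ?thesis unfolding * using AE_F_minus by eventually_elim (simp add: d_def)
    qed simp
    then show "AE \<omega> in PiM UNIV F_mixed. minus_edge e \<longrightarrow> \<omega> e \<le> d"
      by (intro AE_PiM_component mixed.prob_D UNIV_I)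
  qed
  then have bound: "AE \<omega> in PiM UNIV F_mixed. mixed.T (3 * k) \<omega> \<le> 2 * d + (\<Sum>j<k. 3 * d - (d - 1/2) * ?g j \<omega>)"
    using mixed.AE_clip mixed.AE_env_support
  proof eventually_elim
    case (elim \<omega>)
    have "passage_time \<omega> (0, 0) (0, int (3 * k)) \<le> 2 * d + (\<Sum>j<k. 3 * d - (d - 1/2) * ?g j \<omega>)"
      by (rule mixed_passage_time_le) (use elim in blast)+
    with elim show ?case by (simp only: mixed.T_def)
  qed
  have "(\<integral>\<omega>. mixed.T (3 * k) \<omega> \<partial>PiM UNIV F_mixed) \<le>
      (\<integral>\<omega>. 2 * d + (\<Sum>j<k. 3 * d - (d - 1/2) * ?g j \<omega>) \<partial>PiM UNIV F_mixed)"
    using int_g by (intro integral_mono_AE mixed.integrable_T bound) auto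
  also have "\<dots> = 2 * d + real k * (3 * d - (d - 1/2) * (1/32) ^ 3)"
    using int_g by (simp add: E_g mixed.prob_space)
  also have "\<dots> < 3 * real k" by (simp add: d_def k(2) power_divide)
  finally have "(\<integral>\<omega>. mixed.T (3 * k) \<omega> \<partial>PiM UNIV F_mixed) / real (3 * k) < 1"
    using k(1) by (simp add: divide_less_eq)
  moreover have "mixed.mu \<le> (\<integral>\<omega>. mixed.T (3 * k) \<omega> \<partial>PiM UNIV F_mixed) / real (3 * k)"
    by (rule mixed.mu_le) (use k(1) in simp)
  ultimately show ?thesis by linarith
qed

theorem theorem5:
  shows "\<exists>Fm Fp :: real measure.
     distr_nonneg Fm \<and> distr_nonneg Fp \<and> nondegenerate Fm \<and> nondegenerate Fp \<and>
     bounded_support Fm \<and> bounded_support Fp \<and>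
     (\<exists>cbar cm cp. is_mu_bar_e2 Fm Fp cbar \<and> is_time_constant Fm e2 cm \<and>
        is_time_constant Fp e2 cp \<and> cbar < min cm cp)"
proof (intro exI conjI)
  show "distr_nonneg F_minus" "distr_nonneg F_plus" "nondegenerate F_minus" "nondegenerate F_plus"
    "bounded_support F_minus" "bounded_support F_plus"
    unfolding F_minus_def F_plus_def
    by (intro distr_nonneg_two_point nondegenerate_two_point bounded_support_two_point; simp)+
  have env: "inhom_env F_minus F_plus = PiM UNIV F_mixed"
    by (simp add: inhom_env_def F_mixed_def[abs_def])
  show "is_mu_bar_e2 F_minus F_plus mixed.mu"
    unfolding is_mu_bar_e2_def env by (rule mixed.AE_passage_time_converges)
  show "is_time_constant F_minus e2 minus.mu" "is_time_constant F_plus e2 plus.mu"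
    using minus.passage_time_converges_in_measure plus.passage_time_converges_in_measure
    by (auto simp: is_time_constant_def hom_env_def)
  show "mixed.mu < min minus.mu plus.mu"
    using mu_mixed_less mu_minus_ge mu_plus_ge by simp
qed

end
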